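(* Let $(V_0^*,\Phi,V_0,\Phi^\vee)$ be a real root system with finite Weyl group $W$, let $V=\mathbb C\otimes_{\mathbb R}V_0$ with its $W$-invariant symmetric form $B$, let $n=\dim V$, and let $k:\Phi\to\mathbb C$ be a $W$-invariant parameter function. In the Weyl algebra $\mathcal W(V\oplus V^*,\omega)$ the elements $\nu'(\Omega'_W)$ and $\Omega(\mathfrak{sl}(2))$ satisfy the linear relation $$\nu'(\Omega'_W)=\left(\frac{(n-4)\,(\nu'(\Omega'_W))_0}{n-1}\right)+\left(\frac{-4\,(\nu'(\Omega'_W))_0}{n(n-1)}\right)\Omega(\mathfrak{sl}(2)).$$
   Context: $V_0$ is a finite-dimensional real vector space, $\Phi\subset V_0^*$ the roots, $\Phi^\vee\subset V_0$ the coroots $\alpha^\vee$, $W$ is generated by the reflections $s_\alpha(v)=v-\alpha(v)\alpha^\vee$, and $B$ is a positive-definite $W$-invariant symmetric bilinear form on $V_0$, extended complex-bilinearly to $V$. Fix positive roots; $\alpha>0$ means $\alpha$ is positive. $\mathcal W=\mathcal W(V\oplus V^*,\omega)$ is the Weyl algebra: the quotient of the tensor algebra of $V\oplus V^*$ by $vw-wv=\omega(v,w)$, where $V,V^*$ are isotropic and $\omega(\lambda,v)=\lambda(v)$ for $\lambda\in V^*,v\in V$. $\nu':\mathfrak{so}(V,B)\to\mathcal W$ is $\nu'(f)=\sum_if(v_i)v_i^*$ ($\{v_i\}$ a basis of $V$, $\{v_i^*\}$ the dual basis of $V^*$). Set $$\nu'(\Omega'_W)=\frac1{16}\sum_{\alpha,\beta>0}k_\alpha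 k_\beta\frac1{B(\alpha^\vee,\beta^\vee)}\nu'([s_\alpha,s_\beta])^2\in\mathcal W,$$ where $[s_\alpha,s_\beta]=s_\alpha s_\beta-s_\beta s_\alpha$ is regarded in $\mathfrak{so}(V,B)$ and pairs with $B(\alpha^\vee,\beta^\vee)=0$ (for which $[s_\alpha,s_\beta]=0$) contribute $0$. $\eta:\mathcal W\to S(V\oplus V^* )$ is the linear isomorphism inverse to the symmetrization map $Q(u_1\cdots u_m)=\frac1{m!}\sum_{\sigma\in S_m}u_{\sigma(1)}\cdots u_{\sigma(m)}$, and $(x)_0$ denotes the degree $0$ component of $\eta(x)$. Let $\{v_i\}$ be an orthonormal basis of $(V,B)$, $e_i$ and $f_i$ the images in $\mathcal W$ of $v_i$ and $v_i^*$ (so $[f_j,e_i]=\delta_{ij}$). Put $X=-\frac12\sum_jf_j^2$, $H=-\sum_je_jf_j-\frac n2$, $Y=\frac12\sum_je_j^2$, an $\mathfrak{sl}(2)$-triple, and $\Omega(\mathfrak{sl}(2))=H^2+2(XY+YX)\in\mathcal W$.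
   Formalization: The root system is assumed irreducible and spanning (W acts irreducibly on V_0); without this the relation fails, e.g. for A_2 × A_1 with n = 3 and k = 1, and in the excluded cases where it holds both sides are 0. *)

theory Defs
  imports "HOL-Analysis.Analysis" "HOL-Library.Poly_Mapping"
begin

section \<open>Root systems\<close>

text \<open>
  A finite-dimensional real vector space is written in coordinates as \<^typ>\<open>real^'n\<close>, its
  complexification as \<^typ>\<open>complex^'n\<close>, and their dual spaces as spaces of row vectors, paired with
  the original space by \<open>pairing\<close>. The form \<open>B\<close> is unrelated to the dot product of coordinates.
\<close>

definition pairing :: "'a::comm_ring_1^'n \<Rightarrow> 'a^'n \<Rightarrow> 'a"
  where "pairing l v = (\<Sum>i\<in>UNIV. l $ i * v $ i)"

definition reflect :: "'a::comm_ring_1^'n \<Rightarrow> 'a^'n \<Rightarrow> 'a^'n \<Rightarrow> 'a^'n"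
  where "reflect a c v = v - pairing a v *s c"

text \<open>
  \<open>reflect \<alpha> \<alpha>\<^sup>\<or>\<close> is the reflection \<open>s\<^sub>\<alpha>\<close> of the space of column vectors, and
  \<open>reflect \<alpha>\<^sup>\<or> \<alpha>\<close> is the contragredient reflection of the space of row vectors.
  Neither crystallographic nor reduced nor spanning root systems are required.
\<close>

definition root_system :: "(real^'n) set \<Rightarrow> (real^'n \<Rightarrow> real^'n) \<Rightarrow> bool"
  where "root_system Phi coroot \<longleftrightarrow>
    finite Phi \<and> inj_on coroot Phi \<and>
    (\<forall>\<alpha>\<in>Phi. pairing \<alpha> (coroot \<alpha>) = 2 \<and>
       reflect (coroot \<alpha>) \<alpha> ` Phi = Phi \<and>
       reflect \<alpha> (coroot \<alpha>) ` (coroot ` Phi) = coroot ` Phi)"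

inductive_set weyl_group :: "(real^'n) set \<Rightarrow> (real^'n \<Rightarrow> real^'n) \<Rightarrow> (real^'n \<Rightarrow> real^'n) set"
  for Phi coroot where
  weyl_group_id: "id \<in> weyl_group Phi coroot"
| weyl_group_refl: "\<alpha> \<in> Phi \<Longrightarrow> w \<in> weyl_group Phi coroot \<Longrightarrow>
    reflect \<alpha> (coroot \<alpha>) \<circ> w \<in> weyl_group Phi coroot"

text \<open>
  Irreducibility of the reflection representation. The linear relation between \<open>\<nu>'(\<Omega>'\<^sub>W)\<close> and
  the Casimir element fails without it, for example for \<open>B\<^sub>2 \<times> A\<^sub>1\<close> in dimension 3.
\<close>

definition irreducible_action :: "(real^'n \<Rightarrow> real^'n) set \<Rightarrow> bool"
  where "irreducible_action W \<longleftrightarrow>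
    (\<forall>S. subspace S \<and> (\<forall>w\<in>W. w ` S \<subseteq> S) \<longrightarrow> S = {0} \<or> S = UNIV)"

definition positive_roots :: "(real^'n) set \<Rightarrow> (real^'n) set \<Rightarrow> bool"
  where "positive_roots Phi P \<longleftrightarrow>
    (\<exists>x. (\<forall>\<alpha>\<in>Phi. pairing \<alpha> x \<noteq> 0) \<and> P = {\<alpha>\<in>Phi. pairing \<alpha> x > 0})"

text \<open>Invariance under the generating reflections is invariance under the whole group.\<close>

definition invariant_parameter ::
    "(real^'n) set \<Rightarrow> (real^'n \<Rightarrow> real^'n) \<Rightarrow> (real^'n \<Rightarrow> complex) \<Rightarrow> bool"
  where "invariant_parameter Phi coroot k \<longleftrightarrow>
    (\<forall>\<alpha>\<in>Phi. \<forall>\<beta>\<in>Phi. k (reflect (coroot \<alpha>) \<alpha> \<beta>) = k \<beta>)"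

definition invariant_inner_form ::
    "(real^'n \<Rightarrow> real^'n) set \<Rightarrow> (real^'n \<Rightarrow> real^'n \<Rightarrow> real) \<Rightarrow> bool"
  where "invariant_inner_form W B \<longleftrightarrow>
    bilinear B \<and> (\<forall>u v. B u v = B v u) \<and> (\<forall>v. v \<noteq> 0 \<longrightarrow> B v v > 0) \<and>
    (\<forall>w\<in>W. \<forall>u v. B (w u) (w v) = B u v)"

definition cvec :: "real^'n \<Rightarrow> complex^'n"
  where "cvec v = (\<chi> i. of_real (v $ i))"

definition re_vec :: "complex^'n \<Rightarrow> real^'n"
  where "re_vec v = (\<chi> i. Re (v $ i))"

definition im_vec :: "complex^'n \<Rightarrow> real^'n"
  where "im_vec v = (\<chi> i. Im (v $ i))"

text \<open>The complex-bilinear extension of a real bilinear form.\<close>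

definition cform :: "(real^'n \<Rightarrow> real^'n \<Rightarrow> real) \<Rightarrow> complex^'n \<Rightarrow> complex^'n \<Rightarrow> complex"
  where "cform B u v =
    Complex (B (re_vec u) (re_vec v) - B (im_vec u) (im_vec v))
            (B (re_vec u) (im_vec v) + B (im_vec u) (re_vec v))"

text \<open>
  A family of vectors indexed by \<^typ>\<open>'n\<close> that is orthonormal for the extended form is linearly
  independent, hence a basis of \<^typ>\<open>complex^'n\<close>, and has exactly one dual family.
\<close>

definition orthonormal_family ::
    "(real^'n \<Rightarrow> real^'n \<Rightarrow> real) \<Rightarrow> ('n \<Rightarrow> complex^'n) \<Rightarrow> bool"
  where "orthonormal_family B b \<longleftrightarrow> (\<forall>i j. cform B (b i) (b j) = (if i = j then 1 else 0))"

definition dual_family :: "('n \<Rightarrow> complex^'n) \<Rightarrow> ('n \<Rightarrow> complex^'n) \<Rightarrow> bool"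
  where "dual_family b d \<longleftrightarrow> (\<forall>i j. pairing (d j) (b i) = (if i = j then 1 else 0))"


section \<open>Two-sided ideals\<close>

inductive_set ideal2 :: "'a::{ring,monoid_mult} set \<Rightarrow> 'a set" for R where
  ideal2_zero: "0 \<in> ideal2 R"
| ideal2_add: "r \<in> R \<Longrightarrow> x \<in> ideal2 R \<Longrightarrow> a * r * b + x \<in> ideal2 R"

lemma ideal2_plus: "x \<in> ideal2 R \<Longrightarrow> y \<in> ideal2 R \<Longrightarrow> x + y \<in> ideal2 R"
  by (induction rule: ideal2.induct) (auto simp: add.assoc intro: ideal2.intros)

lemma ideal2_left: "x \<in> ideal2 R \<Longrightarrow> c * x \<in> ideal2 R"
proof (induction rule: ideal2.induct)
  case (ideal2_add r x a b)
  have "c * (a * r * b + x) = (c * a) * r * b + c * x" by (simp add: algebra_simps)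
  then show ?case using ideal2_add by (metis ideal2.ideal2_add)
qed (simp add: ideal2_zero)

lemma ideal2_right: "x \<in> ideal2 R \<Longrightarrow> x * c \<in> ideal2 R"
proof (induction rule: ideal2.induct)
  case (ideal2_add r x a b)
  have "(a * r * b + x) * c = a * r * (b * c) + x * c" by (simp add: algebra_simps)
  then show ?case using ideal2_add by (metis ideal2.ideal2_add)
qed (simp add: ideal2_zero)

lemma ideal2_uminus: "x \<in> ideal2 R \<Longrightarrow> - x \<in> ideal2 R"
  using ideal2_left[of x R "- 1"] by simp

lemma ideal2_diff: "x \<in> ideal2 R \<Longrightarrow> y \<in> ideal2 R \<Longrightarrow> x - y \<in> ideal2 R"
  using ideal2_plus[of x R "- y"] ideal2_uminus by auto

lemma ideal2_relator: "r \<in> R \<Longrightarrow> r \<in> ideal2 R"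
  using ideal2_add[OF _ ideal2_zero, of r R 1 1] by simp

definition ideal_rel :: "'a::{ring,monoid_mult} set \<Rightarrow> 'a \<Rightarrow> 'a \<Rightarrow> bool"
  where "ideal_rel R x y \<longleftrightarrow> x - y \<in> ideal2 R"

lemma equivp_ideal_rel: "equivp (ideal_rel R)"
proof (rule equivpI)
  show "reflp (ideal_rel R)" by (auto intro!: reflpI simp: ideal_rel_def ideal2_zero)
  show "symp (ideal_rel R)"
    by (intro sympI) (metis ideal_rel_def ideal2_uminus minus_diff_eq)
  show "transp (ideal_rel R)"
  proof (rule transpI)
    fix x y z assume "ideal_rel R x y" "ideal_rel R y z"
    then show "ideal_rel R x z"
      using ideal2_plus[of "x - y" R "y - z"] by (simp add: ideal_rel_def)
  qed
qed

lemma ideal_rel_add: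
  "ideal_rel R x x' \<Longrightarrow> ideal_rel R y y' \<Longrightarrow> ideal_rel R (x + y) (x' + y')"
  using ideal2_plus[of "x - x'" R "y - y'"] by (simp add: ideal_rel_def algebra_simps)

lemma ideal_rel_diff:
  "ideal_rel R x x' \<Longrightarrow> ideal_rel R y y' \<Longrightarrow> ideal_rel R (x - y) (x' - y')"
  using ideal2_diff[of "x - x'" R "y - y'"] by (simp add: ideal_rel_def algebra_simps)

lemma ideal_rel_uminus: "ideal_rel R x x' \<Longrightarrow> ideal_rel R (- x) (- x')"
  using ideal2_uminus[of "x - x'" R] by (simp add: ideal_rel_def algebra_simps)

lemma ideal_rel_mult:
  assumes "ideal_rel R x x'" "ideal_rel R y y'"
  shows "ideal_rel R (x * y) (x' * y')"
proof -
  have "x * y - x' * y' = x * (y - y') + (x - x') * y'" by (simp add: algebra_simps)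
  then show ?thesis
    using assms by (auto simp: ideal_rel_def intro: ideal2_plus ideal2_left ideal2_right)
qed


section \<open>The tensor algebra of the doubled space\<close>

text \<open>
  Words form the free monoid, so \<open>'u tword \<Rightarrow>\<^sub>0 complex\<close> is the free associative unital algebra
  on the set \<open>'u\<close>. The tensor algebra of a vector space is the quotient of the free algebra on the
  underlying set that makes the inclusion of generators linear.
\<close>

datatype 'u tword = TWord (letters: "'u list")

instantiation tword :: (type) monoid_add
begin

definition zero_tword :: "'a tword" where "zero_tword = TWord []"
definition plus_tword :: "'a tword \<Rightarrow> 'a tword \<Rightarrow> 'a tword"
  where "plus_tword v w = TWord (letters v @ letters w)"

instance by standard (auto simp: zero_tword_def plus_tword_def)

end

text \<open>A pair \<open>(v, l)\<close> consists of a vector \<open>v\<close> and a covector \<open>l\<close>.\<close>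

type_synonym ('n) doubled = "(complex^'n) \<times> (complex^'n)"

definition dscale :: "complex \<Rightarrow> ('n::finite) doubled \<Rightarrow> 'n doubled"
  where "dscale c u = (c *s fst u, c *s snd u)"

definition omega :: "('n::finite) doubled \<Rightarrow> 'n doubled \<Rightarrow> complex"
  where "omega u u' = pairing (snd u) (fst u') - pairing (snd u') (fst u)"

definition free_gen :: "'u \<Rightarrow> 'u tword \<Rightarrow>\<^sub>0 complex"
  where "free_gen u = Poly_Mapping.single (TWord [u]) 1"

definition free_const :: "complex \<Rightarrow> 'u tword \<Rightarrow>\<^sub>0 complex"
  where "free_const c = Poly_Mapping.single 0 c"

definition linear_relators :: "(('n::finite) doubled tword \<Rightarrow>\<^sub>0 complex) set"
  where "linear_relators =
    {free_gen (u + v) - free_gen u - free_gen v | u v. True} \<union>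
    {free_gen (dscale c u) - free_const c * free_gen u | c u. True}"

quotient_type (overloaded) 'n tensor_alg =
  "('n::finite) doubled tword \<Rightarrow>\<^sub>0 complex" / "ideal_rel linear_relators"
  by (rule equivp_ideal_rel)

instantiation tensor_alg :: (finite) "{ring,monoid_mult}"
begin

lift_definition zero_tensor_alg :: "'a tensor_alg" is 0 .
lift_definition one_tensor_alg :: "'a tensor_alg" is 1 .
lift_definition plus_tensor_alg :: "'a tensor_alg \<Rightarrow> 'a tensor_alg \<Rightarrow> 'a tensor_alg" is "(+)"
  by (rule ideal_rel_add)
lift_definition minus_tensor_alg :: "'a tensor_alg \<Rightarrow> 'a tensor_alg \<Rightarrow> 'a tensor_alg" is "(-)"
  by (rule ideal_rel_diff)
lift_definition uminus_tensor_alg :: "'a tensor_alg \<Rightarrow> 'a tensor_alg" is uminus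
  by (rule ideal_rel_uminus)
lift_definition times_tensor_alg :: "'a tensor_alg \<Rightarrow> 'a tensor_alg \<Rightarrow> 'a tensor_alg" is "(*)"
  by (rule ideal_rel_mult)

instance
  by standard (transfer, simp add: algebra_simps equivp_reflp[OF equivp_ideal_rel])+

end

lift_definition tgen :: "('n::finite) doubled \<Rightarrow> 'n tensor_alg" is free_gen .
lift_definition tconst :: "complex \<Rightarrow> ('n::finite) tensor_alg" is free_const .


section \<open>The Weyl algebra\<close>

text \<open>
  As \<open>omega\<close> is bilinear, the relators for vectors and covectors are equivalent to these relators
  for arbitrary elements of the doubled space.
\<close>

definition weyl_relators :: "('n::finite) tensor_alg set"
  where "weyl_relators = {tgen u * tgen v - tgen v * tgen u - tconst (omega u v) | u v. True}"

quotient_type (overloaded) 'n weyl_alg =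
  "('n::finite) tensor_alg" / "ideal_rel weyl_relators"
  by (rule equivp_ideal_rel)

instantiation weyl_alg :: (finite) "{ring,monoid_mult}"
begin

lift_definition zero_weyl_alg :: "'a weyl_alg" is 0 .
lift_definition one_weyl_alg :: "'a weyl_alg" is 1 .
lift_definition plus_weyl_alg :: "'a weyl_alg \<Rightarrow> 'a weyl_alg \<Rightarrow> 'a weyl_alg" is "(+)"
  by (rule ideal_rel_add)
lift_definition minus_weyl_alg :: "'a weyl_alg \<Rightarrow> 'a weyl_alg \<Rightarrow> 'a weyl_alg" is "(-)"
  by (rule ideal_rel_diff)
lift_definition uminus_weyl_alg :: "'a weyl_alg \<Rightarrow> 'a weyl_alg" is uminus
  by (rule ideal_rel_uminus)
lift_definition times_weyl_alg :: "'a weyl_alg \<Rightarrow> 'a weyl_alg \<Rightarrow> 'a weyl_alg" is "(*)"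
  by (rule ideal_rel_mult)

instance
  by standard (transfer, simp add: algebra_simps equivp_reflp[OF equivp_ideal_rel])+

end

lift_definition wgen :: "('n::finite) doubled \<Rightarrow> 'n weyl_alg" is tgen .
lift_definition wconst :: "complex \<Rightarrow> ('n::finite) weyl_alg" is tconst .


section \<open>Symmetrization\<close>

definition sym_relators :: "('n::finite) tensor_alg set"
  where "sym_relators = {tgen u * tgen v - tgen v * tgen u | u v. True}"

quotient_type (overloaded) 'n sym_alg =
  "('n::finite) tensor_alg" / "ideal_rel sym_relators"
  by (rule equivp_ideal_rel)

lemma free_induct [case_names zero add]:
  fixes p :: "'u tword \<Rightarrow>\<^sub>0 complex"
  assumes "P 0" and "\<And>us c q. P q \<Longrightarrow> P (Poly_Mapping.single (TWord us) c + q)"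
  shows "P p"
proof -
  have step: "P (Poly_Mapping.single w c + q)" if "P q" for w c q
    using assms(2)[OF that, of "letters w" c] by simp
  have "P (\<Sum>w\<in>A. Poly_Mapping.single w (Poly_Mapping.lookup p w))" if "finite A" for A
    using that by (induction A rule: finite_induct) (auto simp: assms(1) step)
  moreover have "(\<Sum>w\<in>Poly_Mapping.keys p. Poly_Mapping.single w (Poly_Mapping.lookup p w)) = p"
    by (rule poly_mapping_eqI)
       (auto simp: lookup_sum lookup_single when_def in_keys_iff cong: if_cong)
  ultimately show ?thesis by (metis finite_keys)
qed

lemma free_const_commutes: "free_const c * p = p * free_const c"
  by (induction p rule: free_induct)
     (auto simp: free_const_def algebra_simps mult_single)

lemma tconst_commutes: "tconst c * x = x * tconst c"
  by transfer (simp add: free_const_commutes equivp_reflp[OF equivp_ideal_rel])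

lemma wconst_commutes: "wconst c * x = x * wconst c"
  by transfer (simp add: tconst_commutes equivp_reflp[OF equivp_ideal_rel])

lemma wconst_left_commute: "x * (wconst c * y) = wconst c * (x * y)"
  by (metis mult.assoc wconst_commutes)

lemma tconst_add: "tconst (c + d) = tconst c + tconst d"
  by transfer (simp add: free_const_def single_add equivp_reflp[OF equivp_ideal_rel])

lemma wconst_add: "wconst (c + d) = wconst c + wconst d"
  by transfer (simp add: tconst_add equivp_reflp[OF equivp_ideal_rel])

lemma tconst_mult: "tconst (c * d) = tconst c * tconst d"
  by transfer (simp add: free_const_def mult_single equivp_reflp[OF equivp_ideal_rel])

lemma wconst_mult: "wconst (c * d) = wconst c * wconst d"
  by transfer (simp add: tconst_mult equivp_reflp[OF equivp_ideal_rel])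

lemma tconst_0: "tconst 0 = 0"
  by transfer (simp add: free_const_def equivp_reflp[OF equivp_ideal_rel])

lemma wconst_0: "wconst 0 = 0"
  by transfer (simp add: tconst_0 equivp_reflp[OF equivp_ideal_rel])

lemma wconst_1: "wconst 1 = 1"
proof -
  have "tconst 1 = (1 :: 'a tensor_alg)"
    by transfer (simp add: free_const_def equivp_reflp[OF equivp_ideal_rel])
  then show ?thesis
    by transfer (simp add: equivp_reflp[OF equivp_ideal_rel])
qed

lemma tgen_add: "tgen (u + v) = tgen u + tgen v"
proof (transfer, unfold ideal_rel_def)
  fix u v :: "'a doubled"
  have "free_gen (u + v) - free_gen u - free_gen v \<in> linear_relators"
    unfolding linear_relators_def by blast
  then show "free_gen (u + v) - (free_gen u + free_gen v) \<in> ideal2 linear_relators"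
    using ideal2_relator by (metis diff_diff_eq)
qed

lemma wgen_add: "wgen (u + v) = wgen u + wgen v"
  by transfer (simp add: tgen_add equivp_reflp[OF equivp_ideal_rel])

lemma tgen_scale: "tgen (dscale c u) = tconst c * tgen u"
proof (transfer, unfold ideal_rel_def)
  fix u :: "'a doubled" and c
  have "free_gen (dscale c u) - free_const c * free_gen u \<in> linear_relators"
    unfolding linear_relators_def by blast
  then show "free_gen (dscale c u) - free_const c * free_gen u \<in> ideal2 linear_relators"
    by (rule ideal2_relator)
qed

lemma wgen_scale: "wgen (dscale c u) = wconst c * wgen u"
  by transfer (simp add: tgen_scale equivp_reflp[OF equivp_ideal_rel])

lemma wgen_commutator: "wgen u * wgen v - wgen v * wgen u = wconst (omega u v)"
proof (transfer, unfold ideal_rel_def)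
  fix u v :: "'a doubled"
  show "tgen u * tgen v - tgen v * tgen u - tconst (omega u v) \<in> ideal2 weyl_relators"
    by (rule ideal2_relator) (unfold weyl_relators_def, blast)
qed

definition symmetrize_word :: "('n::finite) doubled tword \<Rightarrow> 'n weyl_alg"
  where "symmetrize_word w = (let us = letters w; m = length us in
    wconst (1 / fact m) *
      (\<Sum>\<sigma> | \<sigma> permutes {..<m}. prod_list (map (\<lambda>i. wgen (us ! \<sigma> i)) [0..<m])))"

definition symmetrize_free :: "(('n::finite) doubled tword \<Rightarrow>\<^sub>0 complex) \<Rightarrow> 'n weyl_alg"
  where "symmetrize_free p =
    (\<Sum>w\<in>Poly_Mapping.keys p. wconst (Poly_Mapping.lookup p w) * symmetrize_word w)"

lemma symmetrize_free_superset:
  assumes "finite A" "Poly_Mapping.keys p \<subseteq> A"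
  shows "symmetrize_free p =
    (\<Sum>w\<in>A. wconst (Poly_Mapping.lookup p w) * symmetrize_word w)"
  unfolding symmetrize_free_def using assms
  by (intro sum.mono_neutral_left) (auto simp: in_keys_iff wconst_0)

lemma symmetrize_free_add: "symmetrize_free (p + q) = symmetrize_free p + symmetrize_free q"
proof -
  let ?A = "Poly_Mapping.keys p \<union> Poly_Mapping.keys q"
  have "Poly_Mapping.keys (p + q) \<subseteq> ?A" by (rule Poly_Mapping.keys_add)
  then show ?thesis
    by (simp add: symmetrize_free_superset[of ?A] lookup_add wconst_add distrib_right
        sum.distrib)
qed

lemma symmetrize_free_0: "symmetrize_free 0 = 0"
  by (simp add: symmetrize_free_def)

lemma symmetrize_free_uminus: "symmetrize_free (- p) = - symmetrize_free p"
  using symmetrize_free_add[of p "- p"] by (simp add: symmetrize_free_0 eq_neg_iff_add_eq_0 add.commute)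

lemma symmetrize_free_diff: "symmetrize_free (p - q) = symmetrize_free p - symmetrize_free q"
  using symmetrize_free_add[of p "- q"] by (simp add: symmetrize_free_uminus)

lemma symmetrize_free_single:
  "symmetrize_free (Poly_Mapping.single w c) = wconst c * symmetrize_word w"
  by (subst symmetrize_free_superset[of "{w}"]) auto

lemma permuted_product_split:
  fixes g :: "nat \<Rightarrow> 'a::monoid_mult"
  assumes "\<sigma> permutes {..<m}" "l < m"
  obtains i where "i < m" "\<And>j. j < m \<Longrightarrow> j \<noteq> i \<Longrightarrow> \<sigma> j \<noteq> l"
    "\<And>g :: nat \<Rightarrow> 'a. prod_list (map (\<lambda>j. g (\<sigma> j)) [0..<m]) =
      prod_list (map (\<lambda>j. g (\<sigma> j)) [0..<i]) * g l * prod_list (map (\<lambda>j. g (\<sigma> j)) [Suc i..<m])"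
proof -
  from assms obtain i where i: "i < m" "\<sigma> i = l"
    by (metis lessThan_iff permutes_image imageE)
  have "[0..<m] = [0..<i] @ i # [Suc i..<m]"
    using i upt_add_eq_append[of 0 i "m - i"] by (simp add: upt_conv_Cons)
  with i have "prod_list (map (\<lambda>j. g (\<sigma> j)) [0..<m]) =
      prod_list (map (\<lambda>j. g (\<sigma> j)) [0..<i]) * g l * prod_list (map (\<lambda>j. g (\<sigma> j)) [Suc i..<m])"
    for g :: "nat \<Rightarrow> 'a" by (simp add: mult.assoc)
  moreover have "\<sigma> j \<noteq> l" if "j \<noteq> i" for j
    using that i permutes_inj[OF assms(1)] by (auto dest: injD)
  ultimately show ?thesis using i that by blast
qed

lemma symmetrize_word_add:
  fixes u v :: "('n::finite) doubled"
  shows "symmetrize_word (TWord (x @ (u + v) # y)) =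
   symmetrize_word (TWord (x @ u # y)) + symmetrize_word (TWord (x @ v # y))"
proof -
  let ?m = "length x + Suc (length y)" and ?l = "length x"
  let ?G = "\<lambda>u j. wgen ((x @ u # y) ! j)"
  have "prod_list (map (\<lambda>j. ?G (u + v) (\<sigma> j)) [0..<?m]) =
        prod_list (map (\<lambda>j. ?G u (\<sigma> j)) [0..<?m]) +
        prod_list (map (\<lambda>j. ?G v (\<sigma> j)) [0..<?m])"
    if perm: "\<sigma> permutes {..<?m}" for \<sigma>
  proof -
    obtain i where i: "i < ?m" and ne: "\<And>j. j < ?m \<Longrightarrow> j \<noteq> i \<Longrightarrow> \<sigma> j \<noteq> ?l"
      and split: "\<And>g :: nat \<Rightarrow> 'n weyl_alg. prod_list (map (\<lambda>j. g (\<sigma> j)) [0..<?m]) =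
      prod_list (map (\<lambda>j. g (\<sigma> j)) [0..<i]) * g ?l * prod_list (map (\<lambda>j. g (\<sigma> j)) [Suc i..<?m])"
      by (rule permuted_product_split[OF perm, where l = ?l]) auto
    have indep: "?G w (\<sigma> j) = ?G u (\<sigma> j)" if "j < ?m" "j \<noteq> i" for j w
      using ne[OF that] by (auto simp: nth_append nth_Cons')
    have 1: "map (\<lambda>j. ?G w (\<sigma> j)) [0..<i] = map (\<lambda>j. ?G u (\<sigma> j)) [0..<i]"
      and 2: "map (\<lambda>j. ?G w (\<sigma> j)) [Suc i..<?m] = map (\<lambda>j. ?G u (\<sigma> j)) [Suc i..<?m]" for w
      using i by (auto intro!: indep)
    have eq: "prod_list (map (\<lambda>j. ?G w (\<sigma> j)) [0..<?m]) =
      prod_list (map (\<lambda>j. ?G u (\<sigma> j)) [0..<i]) * wgen w *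
      prod_list (map (\<lambda>j. ?G u (\<sigma> j)) [Suc i..<?m])" for w
      using split[of "?G w"] unfolding 1[of w] 2[of w] by simp
    show ?thesis
      unfolding eq[of "u + v"] eq[of v] eq[of u] by (simp add: wgen_add algebra_simps)
  qed
  then show ?thesis
    by (simp add: symmetrize_word_def Let_def sum.distrib distrib_left)
qed

lemma symmetrize_word_scale:
  fixes u :: "('n::finite) doubled"
  shows "symmetrize_word (TWord (x @ dscale c u # y)) = wconst c * symmetrize_word (TWord (x @ u # y))"
proof -
  let ?m = "length x + Suc (length y)" and ?l = "length x"
  let ?G = "\<lambda>u j. wgen ((x @ u # y) ! j)"
  have "prod_list (map (\<lambda>j. ?G (dscale c u) (\<sigma> j)) [0..<?m]) =
        wconst c * prod_list (map (\<lambda>j. ?G u (\<sigma> j)) [0..<?m])"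
    if perm: "\<sigma> permutes {..<?m}" for \<sigma>
  proof -
    obtain i where i: "i < ?m" and ne: "\<And>j. j < ?m \<Longrightarrow> j \<noteq> i \<Longrightarrow> \<sigma> j \<noteq> ?l"
      and split: "\<And>g :: nat \<Rightarrow> 'n weyl_alg. prod_list (map (\<lambda>j. g (\<sigma> j)) [0..<?m]) =
      prod_list (map (\<lambda>j. g (\<sigma> j)) [0..<i]) * g ?l * prod_list (map (\<lambda>j. g (\<sigma> j)) [Suc i..<?m])"
      by (rule permuted_product_split[OF perm, where l = ?l]) auto
    have indep: "?G w (\<sigma> j) = ?G u (\<sigma> j)" if "j < ?m" "j \<noteq> i" for j w
      using ne[OF that] by (auto simp: nth_append nth_Cons')
    have 1: "map (\<lambda>j. ?G w (\<sigma> j)) [0..<i] = map (\<lambda>j. ?G u (\<sigma> j)) [0..<i]"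
      and 2: "map (\<lambda>j. ?G w (\<sigma> j)) [Suc i..<?m] = map (\<lambda>j. ?G u (\<sigma> j)) [Suc i..<?m]" for w
      using i by (auto intro!: indep)
    have eq: "prod_list (map (\<lambda>j. ?G w (\<sigma> j)) [0..<?m]) =
      prod_list (map (\<lambda>j. ?G u (\<sigma> j)) [0..<i]) * wgen w *
      prod_list (map (\<lambda>j. ?G u (\<sigma> j)) [Suc i..<?m])" for w
      using split[of "?G w"] unfolding 1[of w] 2[of w] by simp
    show ?thesis
      unfolding eq[of "dscale c u"] eq[of u] wgen_scale
      by (simp only: mult.assoc wconst_left_commute)
  qed
  then have "(\<Sum>\<sigma> | \<sigma> permutes {..<?m}. prod_list (map (\<lambda>j. ?G (dscale c u) (\<sigma> j)) [0..<?m])) =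
      wconst c * (\<Sum>\<sigma> | \<sigma> permutes {..<?m}. prod_list (map (\<lambda>j. ?G u (\<sigma> j)) [0..<?m]))"
    by (simp add: sum_distrib_left)
  then show ?thesis
    by (simp add: symmetrize_word_def Let_def wconst_left_commute[of "wconst (1 / _)"])
qed

lemma symmetrize_word_swap:
  "symmetrize_word (TWord (x @ u # v # y)) = symmetrize_word (TWord (x @ v # u # y))"
proof -
  let ?m = "Suc (Suc (length x + length y))"
  let ?t = "Transposition.transpose (length x) (Suc (length x))"
  have t: "?t permutes {..<?m}" by (rule permutes_swap_id) auto
  have nth: "(x @ v # u # y) ! j = (x @ u # v # y) ! ?t j" for j
    by (auto simp: nth_append nth_Cons' Transposition.transpose_def)
  have "(\<Sum>\<sigma> | \<sigma> permutes {..<?m}. prod_list (map (\<lambda>i. wgen ((x @ u # v # y) ! \<sigma> i)) [0..<?m])) =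
        (\<Sum>\<sigma> | \<sigma> permutes {..<?m}. prod_list (map (\<lambda>i. wgen ((x @ v # u # y) ! \<sigma> i)) [0..<?m]))"
    using setum_permutations_compose_left[OF t,
        of "\<lambda>\<sigma>. prod_list (map (\<lambda>i. wgen ((x @ u # v # y) ! \<sigma> i)) [0..<?m])"]
    by (simp only: o_def nth[symmetric])
  then show ?thesis by (simp add: symmetrize_word_def Let_def)
qed

lemma free_monomial:
  "Poly_Mapping.single (TWord x) c * free_gen u * Poly_Mapping.single (TWord y) d =
   Poly_Mapping.single (TWord (x @ u # y)) (c * d)"
  by (simp add: free_gen_def mult_single plus_tword_def)

lemma symmetrize_free_relator_monomials:
  assumes "r \<in> linear_relators"
  shows "symmetrize_free
    (Poly_Mapping.single (TWord x) c * r * Poly_Mapping.single (TWord y) d) = 0"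
  using assms unfolding linear_relators_def
proof (elim UnE CollectE exE conjE)
  fix u v :: "'a doubled" assume r: "r = free_gen (u + v) - free_gen u - free_gen v"
  show ?thesis
    unfolding r left_diff_distrib right_diff_distrib free_monomial
    unfolding symmetrize_free_diff symmetrize_free_single symmetrize_word_add
    by (simp add: distrib_left)
next
  fix u :: "'a doubled" and a
  assume r: "r = free_gen (dscale a u) - free_const a * free_gen u"
  have "Poly_Mapping.single (TWord x) c * (free_const a * free_gen u) * Poly_Mapping.single (TWord y) d
    = Poly_Mapping.single (TWord (x @ u # y)) (c * d * a)"
    by (simp add: free_const_def free_gen_def mult_single plus_tword_def zero_tword_def ac_simps)
  then show ?thesis
    unfolding r left_diff_distrib right_diff_distrib free_monomial
    by (simp add: symmetrize_free_diff symmetrize_free_single symmetrize_word_scale wconst_mult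
        mult.assoc)
qed

lemma symmetrize_free_two_sided:
  assumes "\<And>x c y d. symmetrize_free
    (Poly_Mapping.single (TWord x) c * r * Poly_Mapping.single (TWord y) d) = 0"
  shows "symmetrize_free (a * r * b) = 0"
proof (induction a rule: free_induct)
  case (add x c a)
  have "symmetrize_free (Poly_Mapping.single (TWord x) c * r * b) = 0"
    by (induction b rule: free_induct)
       (simp_all add: symmetrize_free_0 symmetrize_free_add distrib_left assms)
  with add show ?case by (simp add: distrib_right symmetrize_free_add)
qed (simp add: symmetrize_free_0)

lemma symmetrize_free_ideal: "p \<in> ideal2 linear_relators \<Longrightarrow> symmetrize_free p = 0"
  by (induction rule: ideal2.induct)
     (simp_all add: symmetrize_free_0 symmetrize_free_add symmetrize_free_two_sided
        symmetrize_free_relator_monomials)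

lift_definition symmetrize_tensor :: "('n::finite) tensor_alg \<Rightarrow> 'n weyl_alg" is symmetrize_free
  using symmetrize_free_ideal by (fastforce simp: ideal_rel_def symmetrize_free_diff)

lemma symmetrize_tensor_ideal: "p \<in> ideal2 sym_relators \<Longrightarrow> symmetrize_tensor p = 0"
proof (induction rule: ideal2.induct)
  case ideal2_zero
  have "symmetrize_tensor (abs_tensor_alg 0 :: 'a tensor_alg) = 0"
    unfolding symmetrize_tensor.abs_eq by (rule symmetrize_free_0)
  then show ?case by (simp add: zero_tensor_alg_def)
next
  case (ideal2_add r p a b)
  have add: "symmetrize_tensor (x + y) = symmetrize_tensor x + symmetrize_tensor y"
    for x y :: "'a tensor_alg"
    by transfer (rule symmetrize_free_add)
  obtain u v where r: "r = tgen u * tgen v - tgen v * tgen u"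
    using ideal2_add unfolding sym_relators_def by blast
  obtain p q where ab: "a = abs_tensor_alg p" "b = abs_tensor_alg q"
    by (metis Quotient3_abs_rep Quotient3_tensor_alg)
  let ?r = "free_gen u * free_gen v - free_gen v * free_gen u"
  have "a * r * b = abs_tensor_alg (p * ?r * q)"
    by (simp add: r ab tgen_def times_tensor_alg.abs_eq minus_tensor_alg.abs_eq)
  moreover have "symmetrize_free (p * ?r * q) = 0"
  proof (rule symmetrize_free_two_sided)
    fix x c y d
    show "symmetrize_free (Poly_Mapping.single (TWord x) c * ?r *
        Poly_Mapping.single (TWord y) d) = 0"
      by (simp add: free_gen_def mult_single plus_tword_def left_diff_distrib right_diff_distrib
          symmetrize_free_diff symmetrize_free_single symmetrize_word_swap[of x u v y])
  qed
  ultimately have "symmetrize_tensor (a * r * b) = 0"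
    by (simp add: symmetrize_tensor.abs_eq)
  with ideal2_add show ?case by (simp add: add)
qed

text \<open>The symmetrization map \<open>Q\<close> from the symmetric algebra to the Weyl algebra.\<close>

lift_definition symmetrize :: "('n::finite) sym_alg \<Rightarrow> 'n weyl_alg" is symmetrize_tensor
proof -
  fix x y :: "'n tensor_alg" assume "ideal_rel sym_relators x y"
  then have "symmetrize_tensor (x - y) = 0"
    by (simp add: ideal_rel_def symmetrize_tensor_ideal)
  moreover have "symmetrize_tensor (x - y) = symmetrize_tensor x - symmetrize_tensor y"
    by transfer (rule symmetrize_free_diff)
  ultimately show "symmetrize_tensor x = symmetrize_tensor y" by simp
qed

definition eta :: "('n::finite) weyl_alg \<Rightarrow> 'n sym_alg"
  where "eta = inv symmetrize"

text \<open>
  The degree 0 component of an element of the free algebra is its coefficient at the empty word.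
  All relators of the symmetric algebra are homogeneous of positive degree, so this descends.
\<close>

lemma lookup_mult_zero:
  fixes p q :: "'u tword \<Rightarrow>\<^sub>0 complex"
  shows "Poly_Mapping.lookup (p * q) 0 = Poly_Mapping.lookup p 0 * Poly_Mapping.lookup q 0"
proof (induction p rule: free_induct)
  case (add x c p)
  have "Poly_Mapping.lookup (Poly_Mapping.single (TWord x) c * q) 0 =
      Poly_Mapping.lookup (Poly_Mapping.single (TWord x) c) 0 * Poly_Mapping.lookup q 0"
    by (induction q rule: free_induct)
       (auto simp: distrib_left lookup_add mult_single lookup_single when_def
          plus_tword_def zero_tword_def)
  with add show ?case by (simp add: distrib_right lookup_add)
qed simp

lemma lookup_linear_relator: "r \<in> linear_relators \<Longrightarrow> Poly_Mapping.lookup r 0 = 0"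
  by (auto simp: linear_relators_def lookup_minus free_gen_def free_const_def mult_single
      plus_tword_def lookup_single when_def zero_tword_def)

lift_definition tensor_degree0 :: "('n::finite) tensor_alg \<Rightarrow> complex"
  is "\<lambda>p. Poly_Mapping.lookup p 0"
proof -
  fix x y :: "'n doubled tword \<Rightarrow>\<^sub>0 complex" assume "ideal_rel linear_relators x y"
  moreover have "Poly_Mapping.lookup p 0 = 0" if "p \<in> ideal2 linear_relators"
    for p :: "'n doubled tword \<Rightarrow>\<^sub>0 complex"
    using that
    by (induction rule: ideal2.induct) (simp_all add: lookup_add lookup_mult_zero lookup_linear_relator)
  ultimately have "Poly_Mapping.lookup (x - y) 0 = 0" by (simp only: ideal_rel_def)
  then show "Poly_Mapping.lookup x 0 = Poly_Mapping.lookup y 0" by (simp add: lookup_minus)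
qed

lift_definition sym_degree0 :: "('n::finite) sym_alg \<Rightarrow> complex" is tensor_degree0
proof -
  fix x y :: "'n tensor_alg" assume xy: "ideal_rel sym_relators x y"
  have mult: "tensor_degree0 (x * y) = tensor_degree0 x * tensor_degree0 y"
    for x y :: "'n tensor_alg" by transfer (rule lookup_mult_zero)
  have add: "tensor_degree0 (x + y) = tensor_degree0 x + tensor_degree0 y"
    for x y :: "'n tensor_alg" by transfer (rule lookup_add)
  have diff: "tensor_degree0 (x - y) = tensor_degree0 x - tensor_degree0 y"
    for x y :: "'n tensor_alg" by transfer (rule lookup_minus)
  have zero: "tensor_degree0 (0 :: 'n tensor_alg) = 0" by transfer simp
  have rel: "tensor_degree0 r = 0" if "r \<in> sym_relators" for r :: "'n tensor_alg"
    using that by (auto simp: sym_relators_def mult diff)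
  have "tensor_degree0 p = 0" if "p \<in> ideal2 sym_relators" for p :: "'n tensor_alg"
    using that by (induction rule: ideal2.induct) (simp_all add: mult add zero rel)
  with xy have "tensor_degree0 (x - y) = 0" by (simp only: ideal_rel_def)
  then show "tensor_degree0 x = tensor_degree0 y" by (simp add: diff)
qed

definition degree0_part :: "('n::finite) weyl_alg \<Rightarrow> complex"
  where "degree0_part x = sym_degree0 (eta x)"


section \<open>The two elements of the Weyl algebra\<close>

definition wvec :: "complex^('n::finite) \<Rightarrow> 'n weyl_alg"
  where "wvec v = wgen (v, 0)"

definition wcovec :: "complex^('n::finite) \<Rightarrow> 'n weyl_alg"
  where "wcovec l = wgen (0, l)"

text \<open>
  The sum does not depend on the basis; \<open>axis i 1\<close> is the standard basis and, read as row vectors,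
  its own dual basis.
\<close>

definition nu :: "(complex^'n \<Rightarrow> complex^'n) \<Rightarrow> ('n::finite) weyl_alg"
  where "nu f = (\<Sum>i\<in>UNIV. wvec (f (axis i 1)) * wcovec (axis i 1))"

definition root_reflection :: "(real^'n \<Rightarrow> real^'n) \<Rightarrow> real^'n \<Rightarrow> complex^'n \<Rightarrow> complex^'n"
  where "root_reflection coroot \<alpha> = reflect (cvec \<alpha>) (cvec (coroot \<alpha>))"

definition reflection_commutator ::
    "(real^'n \<Rightarrow> real^'n) \<Rightarrow> real^'n \<Rightarrow> real^'n \<Rightarrow> complex^'n \<Rightarrow> complex^'n"
  where "reflection_commutator coroot \<alpha> \<beta> v =
    root_reflection coroot \<alpha> (root_reflection coroot \<beta> v) -
    root_reflection coroot \<beta> (root_reflection coroot \<alpha> v)"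

text \<open>Pairs with \<open>B \<alpha>\<^sup>\<or> \<beta>\<^sup>\<or> = 0\<close> contribute 0, since \<open>x / 0 = 0\<close>.\<close>

definition nu_Omega_W ::
    "(real^'n) set \<Rightarrow> (real^'n \<Rightarrow> real^'n) \<Rightarrow> (real^'n \<Rightarrow> real^'n \<Rightarrow> real) \<Rightarrow>
     (real^'n \<Rightarrow> complex) \<Rightarrow> ('n::finite) weyl_alg"
  where "nu_Omega_W P coroot B k =
    wconst (1 / 16) *
      (\<Sum>\<alpha>\<in>P. \<Sum>\<beta>\<in>P.
         wconst (k \<alpha> * k \<beta> * (1 / of_real (B (coroot \<alpha>) (coroot \<beta>)))) *
         (nu (reflection_commutator coroot \<alpha> \<beta>))\<^sup>2)"

definition sl2_X :: "('n \<Rightarrow> complex^'n) \<Rightarrow> ('n::finite) weyl_alg"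
  where "sl2_X d = wconst (- 1 / 2) * (\<Sum>j\<in>UNIV. (wcovec (d j))\<^sup>2)"

definition sl2_H :: "('n \<Rightarrow> complex^'n) \<Rightarrow> ('n \<Rightarrow> complex^'n) \<Rightarrow> ('n::finite) weyl_alg"
  where "sl2_H b d =
    - (\<Sum>j\<in>UNIV. wvec (b j) * wcovec (d j)) - wconst (of_nat CARD('n) / 2)"

definition sl2_Y :: "('n \<Rightarrow> complex^'n) \<Rightarrow> ('n::finite) weyl_alg"
  where "sl2_Y b = wconst (1 / 2) * (\<Sum>j\<in>UNIV. (wvec (b j))\<^sup>2)"

definition Omega_sl2 :: "('n \<Rightarrow> complex^'n) \<Rightarrow> ('n \<Rightarrow> complex^'n) \<Rightarrow> ('n::finite) weyl_alg"
  where "Omega_sl2 b d =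
    (sl2_H b d)\<^sup>2 + wconst 2 * (sl2_X d * sl2_Y b + sl2_Y b * sl2_X d)"

end

(*
  Write a for the coroot of a root alpha. The commutator of two root reflections is
  4 B(a,c) / (B(a,a) B(c,c)) times the infinitesimal rotation of the plane of a and c, so nu'(Omega'_W)
  is the image of the tensor R = sum k k B(a,c) / (B(a,a) B(c,c))^2 (a ^ c) (x) (a ^ c) over pairs of
  positive roots. R does not depend on the choice of positive roots, because replacing the second
  root by its reflection in the first changes the sign of a summand; hence R is W-invariant.
  As the reflection representation is irreducible, an invariant symmetric operator on the exterior
  square is a scalar: every a ^ c is an eigenvector, and eigenspaces inside a ^ V for different
  eigenvalues would be orthogonal and reflection-stable. Thus nu'(Omega'_W) is a multiple of the
  Casimir element of so(n), which is n(n-4)/4 - Omega(sl(2)) and has degree 0 part n(n-1)/4.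
*)

theory Submission
  imports Defs
begin

section \<open>Reflections and invariant forms\<close>

text \<open>The parameter k is complex, so R is a complex symmetric tensor on a real space and no
  spectral theorem diagonalizes it. Eigenvectors have to come from geometry, as products of two
  coroots. What survives of the spectral theory is that different eigenvalues force orthogonality,
  tested against the real positive definite form.

  The obstacle to the degree 0 part is that the Weyl algebra is an iterated quotient and
  \<open>eta\<close> an inverse taken by choice. The remedy is an explicit functional
  \<open>weyl_state\<close> on the Weyl algebra, given on words by Wick contractions, which sends
  any symmetrized element to its constant term.

  The coefficients of the theorem come from eliminating the scalar: if nu'(Omega'_W) is \<kappa>
  times the Casimir element of so(n), its degree 0 part is x = \<kappa> n(n-1)/4. Hence \<kappa> =
  4x/(n(n-1)) and \<kappa> n(n-4)/4 = (n-4)x/(n-1).\<close>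

lemma pairing_simps:
  "pairing l (u + v) = pairing l u + pairing l v"
  "pairing l (u - v) = pairing l u - pairing l v"
  "pairing l (c *s v) = c * pairing l v"
  "pairing (l + m) v = pairing l v + pairing m v"
  "pairing (l - m) v = pairing l v - pairing m v"
  "pairing (c *s l) v = c * pairing l v"
  "pairing (- l) v = - pairing l v"
  "pairing l (- v) = - pairing l v"
  by (simp_all add: pairing_def algebra_simps sum.distrib sum_subtractf sum_distrib_left sum_negf)

lemma pairing_sum: "pairing l (\<Sum>i\<in>A. f i) = (\<Sum>i\<in>A. pairing l (f i))"
  by (simp add: pairing_def sum_distrib_left) (rule sum.swap)

lemma pairing_scaleR [simp]: "pairing l (c *\<^sub>R v) = c * pairing l v" for l v :: "real^'n"
  by (simp add: pairing_simps flip: scalar_mult_eq_scaleR)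

lemma pairing_commute: "pairing u v = pairing v u"
  by (simp add: pairing_def mult.commute)

lemma pairing_eqI: "(\<And>v. pairing l v = pairing m v) \<Longrightarrow> l = m"
proof -
  assume *: "\<And>v. pairing l v = pairing m v"
  have "pairing l (axis i 1) = l $ i" for l :: "'a^'n" and i
    by (simp add: pairing_def axis_def if_distrib cong: if_cong)
  with * show "l = m" by (metis vec_eq_iff)
qed

lemma reflect_scaleR: "reflect a c v = v - pairing a v *\<^sub>R c" for v :: "real^'n"
  by (simp add: reflect_def scalar_mult_eq_scaleR)

lemma irreducible_stable_subspace:
  assumes irr: "irreducible_action (weyl_group Phi coroot)"
    and S: "subspace S" and stable: "\<And>\<alpha> v. \<alpha> \<in> Phi \<Longrightarrow> v \<in> S \<Longrightarrow> reflect \<alpha> (coroot \<alpha>) v \<in> S"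
    and nz: "c \<in> S" "c \<noteq> 0"
  shows "S = UNIV"
proof -
  have "w v \<in> S" if "w \<in> weyl_group Phi coroot" "v \<in> S" for w v
    using that by (induction rule: weyl_group.induct) (auto intro: stable)
  with irr S have "S = {0} \<or> S = UNIV"
    unfolding irreducible_action_def by blast
  with nz show ?thesis by auto
qed

locale root_form =
  fixes Phi :: "(real^'n) set" and coroot :: "real^'n \<Rightarrow> real^'n"
    and B :: "real^'n \<Rightarrow> real^'n \<Rightarrow> real"
  assumes roots: "root_system Phi coroot"
    and form: "invariant_inner_form (weyl_group Phi coroot) B"
begin

abbreviation s where "s \<gamma> \<equiv> reflect \<gamma> (coroot \<gamma>)"
abbreviation sd where "sd \<gamma> \<equiv> reflect (coroot \<gamma>) \<gamma>"

lemma finite_roots: "finite Phi"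
  using roots by (simp add: root_system_def)

lemma bilinear_form: "bilinear B"
  using form by (simp add: invariant_inner_form_def)

lemmas form_simps =
  bilinear_ladd[OF bilinear_form] bilinear_radd[OF bilinear_form]
  bilinear_lsub[OF bilinear_form] bilinear_rsub[OF bilinear_form]
  bilinear_lmul[OF bilinear_form] bilinear_rmul[OF bilinear_form]
  bilinear_lneg[OF bilinear_form] bilinear_rneg[OF bilinear_form]
  bilinear_lzero[OF bilinear_form] bilinear_rzero[OF bilinear_form]

lemma form_commute: "B u v = B v u"
  using form by (simp add: invariant_inner_form_def)

lemma form_eq_0_iff: "B v v = 0 \<longleftrightarrow> v = 0"
  using form by (auto simp: invariant_inner_form_def form_simps)

lemma form_reflect: "\<gamma> \<in> Phi \<Longrightarrow> B (s \<gamma> u) (s \<gamma> v) = B u v"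
proof -
  assume "\<gamma> \<in> Phi"
  then have "s \<gamma> \<in> weyl_group Phi coroot"
    using weyl_group_refl[OF _ weyl_group_id] by fastforce
  with form show ?thesis by (simp add: invariant_inner_form_def)
qed

lemma pairing_coroot: "\<gamma> \<in> Phi \<Longrightarrow> pairing \<gamma> (coroot \<gamma>) = 2"
  using roots by (simp add: root_system_def)

lemma coroot_nonzero: "\<gamma> \<in> Phi \<Longrightarrow> coroot \<gamma> \<noteq> 0"
  using pairing_coroot[of \<gamma>] by (auto simp: pairing_def)

lemma form_coroot_nonzero: "\<gamma> \<in> Phi \<Longrightarrow> B (coroot \<gamma>) (coroot \<gamma>) \<noteq> 0"
  using coroot_nonzero by (simp add: form_eq_0_iff)

lemma reflect_coroot: "\<gamma> \<in> Phi \<Longrightarrow> s \<gamma> (coroot \<gamma>) = - coroot \<gamma>"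
  by (simp add: reflect_scaleR pairing_coroot scaleR_2)

text \<open>Invariance gives B v c = B (s v) (s c) = - B (s v) c for the coroot c, and expanding s v
  solves for the pairing. From here on roots can be expressed through coroots and B.\<close>

lemma root_eq_form:
  assumes "\<gamma> \<in> Phi"
  shows "pairing \<gamma> v = 2 * B (coroot \<gamma>) v / B (coroot \<gamma>) (coroot \<gamma>)"
  using form_reflect[OF assms, of v "coroot \<gamma>"] form_coroot_nonzero[OF assms]
  unfolding reflect_coroot[OF assms]
  by (simp add: reflect_scaleR form_simps form_commute field_simps)

lemma reflect_involution: "\<gamma> \<in> Phi \<Longrightarrow> s \<gamma> (s \<gamma> v) = v"
  by (simp add: reflect_scaleR pairing_simps pairing_coroot algebra_simps flip: scaleR_add_left)

lemma form_reflect_left: "\<gamma> \<in> Phi \<Longrightarrow> B (s \<gamma> u) v = B u (s \<gamma> v)"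
  using form_reflect[of \<gamma> u "s \<gamma> v"] by (simp add: reflect_involution)

lemma pairing_dual_reflect: "pairing (sd \<gamma> \<beta>) v = pairing \<beta> (s \<gamma> v)"
  by (simp add: reflect_def pairing_simps pairing_commute)

lemma dual_reflect_in: "\<gamma> \<in> Phi \<Longrightarrow> \<beta> \<in> Phi \<Longrightarrow> sd \<gamma> \<beta> \<in> Phi"
  using roots unfolding root_system_def by blast

lemma dual_reflect_involution: "\<gamma> \<in> Phi \<Longrightarrow> sd \<gamma> (sd \<gamma> \<beta>) = \<beta>"
  by (rule pairing_eqI) (simp add: pairing_dual_reflect reflect_involution)

lemma dual_reflect_bij: "\<gamma> \<in> Phi \<Longrightarrow> bij_betw (sd \<gamma>) Phi Phi"
  by (rule bij_betw_byWitness[where f' = "sd \<gamma>"])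
     (auto simp: dual_reflect_involution dual_reflect_in)

text \<open>Equal functionals make u and w proportional, and evaluation at u and at w gives B u u =
  B u w = B w w, so the factor is 1. With \<open>root_eq_form\<close> this recovers a coroot from
  its root.\<close>

lemma normalized_form_inj:
  assumes "u \<noteq> 0" "w \<noteq> 0" "\<And>v. B u v / B u u = B w v / B w w"
  shows "u = w"
proof -
  have nz: "B u u \<noteq> 0" "B w w \<noteq> 0" using assms by (simp_all add: form_eq_0_iff)
  let ?z = "B w w *\<^sub>R u - B u u *\<^sub>R w"
  have "B ?z v = 0" for v using assms(3)[of v] nz by (simp add: form_simps field_simps)
  then have z: "?z = 0" using form_eq_0_iff by blast
  have "B u w = B w w" "B u u = B u w"
    using assms(3)[of w] assms(3)[of u] nz by (simp_all add: form_commute field_simps)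
  with z nz show ?thesis by simp
qed

text \<open>The axioms only let reflections permute the set of coroots. Compatibility with the map
  \<open>coroot\<close> is due to the form, through which a root determines its coroot.\<close>

lemma coroot_dual_reflect:
  assumes "\<gamma> \<in> Phi" "\<beta> \<in> Phi"
  shows "coroot (sd \<gamma> \<beta>) = s \<gamma> (coroot \<beta>)"
proof (rule normalized_form_inj)
  show "coroot (sd \<gamma> \<beta>) \<noteq> 0" using assms by (simp add: coroot_nonzero dual_reflect_in)
  have "B (s \<gamma> (coroot \<beta>)) (s \<gamma> (coroot \<beta>)) \<noteq> 0"
    using assms by (simp add: form_reflect form_coroot_nonzero)
  then show "s \<gamma> (coroot \<beta>) \<noteq> 0" by (auto simp: form_simps)
  show "B (coroot (sd \<gamma> \<beta>)) v / B (coroot (sd \<gamma> \<beta>)) (coroot (sd \<gamma> \<beta>)) =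
    B (s \<gamma> (coroot \<beta>)) v / B (s \<gamma> (coroot \<beta>)) (s \<gamma> (coroot \<beta>))" for v
    using pairing_dual_reflect[of \<gamma> \<beta> v] assms
      form_reflect_left[of \<gamma> "coroot \<beta>" v]
    by (simp add: root_eq_form dual_reflect_in form_reflect)
qed

lemma uminus_root: "\<gamma> \<in> Phi \<Longrightarrow> sd \<gamma> \<gamma> = - \<gamma>"
  by (simp add: reflect_scaleR pairing_coroot pairing_commute[of "coroot \<gamma>"] scaleR_2)

lemma uminus_root_in: "\<gamma> \<in> Phi \<Longrightarrow> - \<gamma> \<in> Phi"
  using dual_reflect_in[of \<gamma> \<gamma>] by (simp add: uminus_root)

lemma coroot_uminus: "\<gamma> \<in> Phi \<Longrightarrow> coroot (- \<gamma>) = - coroot \<gamma>"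
  using coroot_dual_reflect[of \<gamma> \<gamma>] by (simp add: uminus_root reflect_coroot)

text \<open>The form that B induces on the exterior square, evaluated at x ^ y and v ^ w.\<close>

definition gram :: "real^'n \<Rightarrow> real^'n \<Rightarrow> real^'n \<Rightarrow> real^'n \<Rightarrow> real"
  where "gram x y v w = B x v * B y w - B x w * B y v"

lemma gram_simps:
  "gram (x + x') y v w = gram x y v w + gram x' y v w"
  "gram (c *\<^sub>R x) y v w = c * gram x y v w"
  "gram x (y + y') v w = gram x y v w + gram x y' v w"
  "gram x (y - y') v w = gram x y v w - gram x y' v w"
  "gram x (c *\<^sub>R y) v w = c * gram x y v w"
  "gram (- x) y v w = - gram x y v w"
  "gram 0 y v w = 0"
  "gram x 0 v w = 0"
  by (simp_all add: gram_def form_simps algebra_simps)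

lemma gram_sym:
  "gram x y v w = gram v w x y"
  "gram x y v w = - gram y x v w"
  "gram x x v w = 0"
  by (simp_all add: gram_def form_commute)

text \<open>The equality case of Cauchy-Schwarz: \<open>?z\<close> is B c c times the component of d
  orthogonal to c.\<close>

lemma gram_degenerate:
  assumes "c \<noteq> 0" "gram c d c d = 0"
  obtains t where "d = t *\<^sub>R c"
proof -
  let ?z = "B c c *\<^sub>R d - B c d *\<^sub>R c"
  have "B ?z ?z = B c c * gram c d c d"
    by (simp add: form_simps gram_def form_commute algebra_simps)
  with assms have "B c c *\<^sub>R d = B c d *\<^sub>R c" by (simp add: form_eq_0_iff)
  then have "(1 / B c c) *\<^sub>R B c c *\<^sub>R d = (1 / B c c) *\<^sub>R B c d *\<^sub>R c" by simp
  with assms have "d = (B c d / B c c) *\<^sub>R c" by (simp add: form_eq_0_iff)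
  then show thesis by (rule that)
qed


end

section \<open>Invariant symmetric tensors on the exterior square\<close>

locale invariant_tensor = root_form Phi coroot B
  for Phi :: "(real^'n) set" and coroot B +
  fixes R :: "real^'n \<Rightarrow> real^'n \<Rightarrow> real^'n \<Rightarrow> real^'n \<Rightarrow> complex"
  assumes R_linear: "linear (\<lambda>x. R x y v w)"
    and R_alt: "R x y v w = - R y x v w"
    and R_sym: "R x y v w = R v w x y"
    and R_invariant: "\<gamma> \<in> Phi \<Longrightarrow> R (s \<gamma> x) (s \<gamma> y) (s \<gamma> v) (s \<gamma> w) = R x y v w"
begin

lemma R_simps1:
  "R (x + x') y v w = R x y v w + R x' y v w"
  "R (x - x') y v w = R x y v w - R x' y v w"
  "R (t *\<^sub>R x) y v w = t * R x y v w"
  "R (- x) y v w = - R x y v w"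
  "R 0 y v w = 0"
  using linear_add[OF R_linear] linear_diff[OF R_linear] linear_cmul[OF R_linear]
    linear_neg[OF R_linear] linear_0[OF R_linear]
  by (auto simp: scaleR_conv_of_real)

text \<open>Alternation carries the linearity assumed in the first argument to the second, and
  exchange of the pairs carries it to the last two.\<close>

lemma R_simps2:
  "R x (y + y') v w = R x y v w + R x y' v w"
  "R x (y - y') v w = R x y v w - R x y' v w"
  "R x (t *\<^sub>R y) v w = t * R x y v w"
  "R x 0 v w = 0"
  by (simp_all add: R_alt[of x] R_simps1)

lemma R_simps3:
  "R x y (v + v') w = R x y v w + R x y v' w"
  "R x y (t *\<^sub>R v) w = t * R x y v w"
  by (simp_all add: R_sym[of x y] R_simps1)

lemma R_simps4:
  "R x y v (w + w') = R x y v w + R x y v w'"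
  "R x y v (t *\<^sub>R w) = t * R x y v w"
  by (simp_all add: R_sym[of x y] R_simps2)

lemma R_diag: "R x x v w = 0"
  using R_alt[of x x v w] by simp

lemma R_diag': "R x y v v = 0"
  by (simp add: R_sym[of x y] R_diag)

lemma R_alt': "R x y v w = - R x y w v"
  by (simp add: R_sym[of x y] R_alt[of v])

text \<open>The reflection fixes v and w, negates the coroot, and moves y by a multiple of the
  coroot, which alternation kills. So the value equals its own negative.\<close>

lemma R_coroot_orthogonal:
  assumes "\<gamma> \<in> Phi" "B (coroot \<gamma>) v = 0" "B (coroot \<gamma>) w = 0"
  shows "R (coroot \<gamma>) y v w = 0"
proof -
  have "s \<gamma> v = v" "s \<gamma> w = w"
    using assms by (simp_all add: reflect_scaleR root_eq_form)
  then have "R (- coroot \<gamma>) (y - pairing \<gamma> y *\<^sub>R coroot \<gamma>) v w = R (coroot \<gamma>) y v w"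
    using R_invariant[OF assms(1), of "coroot \<gamma>" y v w] assms(1)
    by (simp add: reflect_coroot reflect_scaleR[of \<gamma> _ y])
  then show ?thesis by (simp add: R_simps1 R_simps2 R_diag)
qed

text \<open>
  On the exterior square the \<open>-1\<close>-eigenspaces of two reflections meet in the line spanned by the
  product of the two coroots, so this product is an eigenvector of \<open>R\<close>.
\<close>

lemma coroot_pair_eigenvector:
  assumes "\<gamma> \<in> Phi" "\<delta> \<in> Phi"
  obtains \<kappa> :: complex where "\<And>v w. R (coroot \<gamma>) (coroot \<delta>) v w = \<kappa> * gram (coroot \<gamma>) (coroot \<delta>) v w"
proof (cases "gram (coroot \<gamma>) (coroot \<delta>) (coroot \<gamma>) (coroot \<delta>) = 0")
  case True
  then obtain t where t: "coroot \<delta> = t *\<^sub>R coroot \<gamma>"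
    using gram_degenerate coroot_nonzero[OF assms(1)] by metis
  show thesis
    by (rule that[of 0]) (simp add: t R_simps2 R_diag)
next
  case False
  define c where "c = coroot \<gamma>"
  define d where "d = coroot \<delta>"
  define \<Delta> where "\<Delta> = gram c d c d"
  have \<Delta>: "\<Delta> \<noteq> 0" "\<Delta> = B c c * B d d - B c d * B c d"
    using False by (simp_all add: \<Delta>_def c_def d_def gram_def form_commute)
  \<comment> \<open>p and q form the basis of the plane of c and d that is dual to c, d under B;
    \<open>ort\<close> projects to the orthogonal complement of that plane.\<close>
  define p where "p = (1 / \<Delta>) *\<^sub>R (B d d *\<^sub>R c - B c d *\<^sub>R d)"
  define q where "q = (1 / \<Delta>) *\<^sub>R (B c c *\<^sub>R d - B c d *\<^sub>R c)"
  have pq: "B c p = 1" "B d p = 0" "B c q = 0" "B d q = 1"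
    using \<Delta> by (simp_all add: p_def q_def form_simps form_commute[of d c] mult.commute)
  define ort where "ort v = v - B c v *\<^sub>R p - B d v *\<^sub>R q" for v
  have ort: "B c (ort v) = 0" "B d (ort v) = 0" for v
    by (simp_all add: ort_def form_simps pq)
  have split: "v = B c v *\<^sub>R p + B d v *\<^sub>R q + ort v" for v
    by (simp add: ort_def)
  have zero_c: "R c d v w = 0" if "B c v = 0" "B c w = 0" for v w
    using R_coroot_orthogonal[OF assms(1)] that by (simp add: c_def)
  have zero_d: "R c d v w = 0" if "B d v = 0" "B d w = 0" for v w
    using R_coroot_orthogonal[OF assms(2)] that by (simp add: d_def R_alt[of "coroot \<gamma>"] c_def)
  \<comment> \<open>p and the complement are orthogonal to d, q and the complement to c, so only the
    pair p, q survives.\<close>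
  have zeros: "R c d p (ort w) = 0" "R c d (ort w) p = 0" "R c d q (ort w) = 0"
    "R c d (ort w) q = 0" "R c d (ort v) (ort w) = 0" for v w
    by (rule zero_c zero_d; simp add: pq ort)+
  show thesis
  \<comment> \<open>gram c d p q = 1, so the value at p, q is the eigenvalue.\<close>
  proof (rule that[of "R c d p q"])
    fix v w
    have "R c d v w = R c d (B c v *\<^sub>R p + B d v *\<^sub>R q + ort v) (B c w *\<^sub>R p + B d w *\<^sub>R q + ort w)"
      using split by metis
    also have "\<dots> = R c d p q * of_real (gram c d v w)"
      unfolding R_simps3 R_simps4 zeros R_diag' R_alt'[of c d q p]
      by (simp add: gram_def algebra_simps)
    finally show "R (coroot \<gamma>) (coroot \<delta>) v w = R c d p q * gram (coroot \<gamma>) (coroot \<delta>) v w"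
      by (simp add: c_def d_def)
  qed
qed

text \<open>Weak form of: x ^ y is an eigenvector of the operator that R defines through
  \<open>gram\<close>. A vanishing product counts for every \<kappa>.\<close>

definition eigen :: "complex \<Rightarrow> real^'n \<Rightarrow> real^'n \<Rightarrow> bool"
  where "eigen \<kappa> x y \<longleftrightarrow> (\<forall>v w. R x y v w = \<kappa> * gram x y v w)"

lemma subspace_eigen: "subspace {y. eigen \<kappa> x y}"
  unfolding subspace_def eigen_def
  by (simp add: R_simps2 gram_simps algebra_simps)

lemma eigen_scale: "eigen \<kappa> x y \<Longrightarrow> eigen \<kappa> (t *\<^sub>R x) y"
  by (simp add: eigen_def R_simps1 gram_simps)

lemma eigen_self: "eigen \<kappa> x x"
  by (simp add: eigen_def R_diag gram_sym(3))

lemma eigen_commute: "eigen \<kappa> x y \<Longrightarrow> eigen \<kappa> y x"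
  by (simp add: eigen_def R_alt[of y x] gram_sym(2)[of y x])

lemma eigen_orthogonal:
  assumes "eigen \<kappa> x y" "eigen \<kappa>' x z" "\<kappa> \<noteq> \<kappa>'"
  shows "gram x y x z = 0"
proof -
  have "R x y x z = \<kappa> * gram x y x z" "R x z x y = \<kappa>' * gram x z x y"
    using assms by (simp_all add: eigen_def)
  then have "\<kappa> * of_real (gram x y x z) = \<kappa>' * of_real (gram x y x z)"
    using R_sym[of x y x z] gram_sym(1)[of x z x y] by metis
  with assms(3) show ?thesis by simp
qed

lemma reflect_in_eigen:
  assumes "eigen \<kappa> x y" "eigen \<kappa> x (coroot \<epsilon>)"
  shows "eigen \<kappa> x (s \<epsilon> y)"
  using subspace_diff[OF subspace_eigen] subspace_mul[OF subspace_eigen] assms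
  by (metis (no_types, lifting) mem_Collect_eq reflect_scaleR)

text \<open>Write c, d, e for the coroots. If c ^ e had another eigenvalue, it would be orthogonal
  to c ^ d, which forces B d e to be nonzero. Then the reflection of e in d is e - t d with t
  nonzero, and c ^ (e - t d) would be an eigenvector although both of its components, in different
  eigenspaces, are nonzero.\<close>

lemma eigen_nonorthogonal_coroots:
  assumes roots: "\<gamma> \<in> Phi" "\<delta> \<in> Phi" "\<epsilon> \<in> Phi"
    and d: "eigen \<kappa> (coroot \<gamma>) (coroot \<delta>)" "B (coroot \<gamma>) (coroot \<delta>) \<noteq> 0"
      "gram (coroot \<gamma>) (coroot \<delta>) (coroot \<gamma>) (coroot \<delta>) \<noteq> 0"
    and e: "B (coroot \<gamma>) (coroot \<epsilon>) \<noteq> 0"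
  shows "eigen \<kappa> (coroot \<gamma>) (coroot \<epsilon>)"
proof (rule ccontr)
  assume ne: "\<not> ?thesis"
  define c where "c = coroot \<gamma>"
  define d' where "d' = coroot \<delta>"
  define e' where "e' = coroot \<epsilon>"
  note defs = c_def d'_def e'_def
  obtain \<mu> where \<mu>: "eigen \<mu> c e'"
    using coroot_pair_eigenvector[OF roots(1,3)] by (auto simp: eigen_def defs)
  have "\<kappa> \<noteq> \<mu>" using ne \<mu> by (auto simp: defs)
  with d(1) \<mu> have ort: "gram c d' c e' = 0" "gram c e' c d' = 0"
    using eigen_orthogonal gram_sym(1) by (auto simp: defs)
  have "gram c e' c e' \<noteq> 0"
  proof
    assume "gram c e' c e' = 0"
    then obtain t where "e' = t *\<^sub>R c"
      using gram_degenerate coroot_nonzero[OF roots(1)] by (metis c_def)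
    then have "eigen \<kappa> c e'"
      using subspace_mul[OF subspace_eigen] eigen_self by blast
    with ne show False by (simp add: defs)
  qed
  define t where "t = pairing \<delta> e'"
  have "B c c * B d' e' = B c d' * B c e'"
    using ort(1) by (simp add: gram_def form_commute)
  then have "B d' e' \<noteq> 0" using d(2) e by (auto simp: defs)
  then have "t \<noteq> 0" using roots(2) by (simp add: t_def root_eq_form defs form_coroot_nonzero)
  have "coroot (sd \<delta> \<epsilon>) = e' - t *\<^sub>R d'"
    unfolding coroot_dual_reflect[OF roots(2,3)] by (simp add: reflect_scaleR defs t_def)
  then obtain \<nu> where \<nu>: "eigen \<nu> c (e' - t *\<^sub>R d')"
    using coroot_pair_eigenvector[OF roots(1) dual_reflect_in[OF roots(2,3)]]
    by (auto simp: eigen_def defs)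
  have eq: "\<mu> * gram c e' v w - t * (\<kappa> * gram c d' v w) =
      \<nu> * (gram c e' v w - t * gram c d' v w)" for v w
    using \<nu> \<mu> d(1) by (simp add: eigen_def R_simps2 gram_simps defs)
  have "\<nu> = \<kappa>"
    using eq[of c d'] ort d(3) \<open>t \<noteq> 0\<close> by (simp add: defs)
  moreover have "\<nu> = \<mu>"
    using eq[of c e'] ort \<open>gram c e' c e' \<noteq> 0\<close> by simp
  ultimately show False using \<open>\<kappa> \<noteq> \<mu>\<close> by simp
qed

text \<open>Take \<kappa> from a coroot neither orthogonal nor parallel to c. A coroot outside the
  \<kappa>-eigenspace is orthogonal to c by the preceding lemma and hence to the eigenspace, so its
  reflection fixes the eigenspace pointwise. The eigenspace is therefore stable, and it contains
  c.\<close>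

lemma coroot_eigen:
  assumes irr: "irreducible_action (weyl_group Phi coroot)" and \<gamma>: "\<gamma> \<in> Phi"
  obtains \<kappa> :: complex where "\<And>y. eigen \<kappa> (coroot \<gamma>) y"
proof -
  define c where "c = coroot \<gamma>"
  have c0: "c \<noteq> 0" using \<gamma> by (simp add: c_def coroot_nonzero)
  show thesis
  proof (cases "\<exists>\<delta>\<in>Phi. B c (coroot \<delta>) \<noteq> 0 \<and> gram c (coroot \<delta>) c (coroot \<delta>) \<noteq> 0")
    case True
    then obtain \<delta> where \<delta>: "\<delta> \<in> Phi" "B c (coroot \<delta>) \<noteq> 0" "gram c (coroot \<delta>) c (coroot \<delta>) \<noteq> 0"
      by blast
    obtain \<kappa> where \<kappa>: "eigen \<kappa> c (coroot \<delta>)"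
      using coroot_pair_eigenvector[OF \<gamma> \<delta>(1)] by (auto simp: eigen_def c_def)
    have "eigen \<kappa> c (s \<epsilon> y)" if \<epsilon>: "\<epsilon> \<in> Phi" and y: "eigen \<kappa> c y" for \<epsilon> y
    proof (cases "eigen \<kappa> c (coroot \<epsilon>)")
      case True
      with y show ?thesis by (rule reflect_in_eigen)
    next
      case False
      then have ce: "B c (coroot \<epsilon>) = 0"
        using eigen_nonorthogonal_coroots[OF \<gamma> \<delta>(1) \<epsilon>] \<delta> \<kappa> by (auto simp: c_def)
      obtain \<mu> where "eigen \<mu> c (coroot \<epsilon>)"
        using coroot_pair_eigenvector[OF \<gamma> \<epsilon>] by (auto simp: eigen_def c_def)
      with False y have "gram c y c (coroot \<epsilon>) = 0"
        using eigen_orthogonal by blast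
      then have "B (coroot \<epsilon>) y = 0"
        using ce c0 by (simp add: gram_def form_commute form_eq_0_iff)
      then have "s \<epsilon> y = y" using \<epsilon> by (simp add: reflect_scaleR root_eq_form)
      with y show ?thesis by simp
    qed
    then have "{y. eigen \<kappa> c y} = UNIV"
      by (intro irreducible_stable_subspace[OF irr subspace_eigen _ _ c0])
         (auto simp: eigen_self)
    then show thesis using that by (auto simp: c_def)
  next
    \<comment> \<open>Every coroot is orthogonal or parallel to c, so the line of c is stable and is
      the whole space. All products c ^ y vanish, and 0 serves as eigenvalue.\<close>
    case False
    have stable: "s \<epsilon> v \<in> span {c}" if \<epsilon>: "\<epsilon> \<in> Phi" and v: "v \<in> span {c}" for \<epsilon> v
    proof -
      obtain r where r: "v = r *\<^sub>R c" using v by (auto simp: span_singleton)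
      show ?thesis
      proof (cases "B c (coroot \<epsilon>) = 0")
        case True
        then have "s \<epsilon> v = v"
          using \<epsilon> by (simp add: r reflect_scaleR root_eq_form form_simps form_commute)
        with v show ?thesis by simp
      next
        case ne: False
        with False \<epsilon> have "gram c (coroot \<epsilon>) c (coroot \<epsilon>) = 0" by blast
        then obtain t where "coroot \<epsilon> = t *\<^sub>R c" using gram_degenerate c0 by metis
        then have "coroot \<epsilon> \<in> span {c}" by (auto simp: span_singleton)
        with v show ?thesis by (simp add: reflect_scaleR span_diff span_scale)
      qed
    qed
    have univ: "span {c} = UNIV"
      by (rule irreducible_stable_subspace[OF irr subspace_span stable _ c0])
         (auto simp: span_base)
    have "eigen 0 c y" for y
    proof -
      have "y \<in> span {c}" by (simp add: univ)
      then obtain t where "y = t *\<^sub>R c" by (auto simp: span_singleton)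
      then show ?thesis by (simp add: eigen_def R_simps2 R_diag)
    qed
    then show thesis using that by (auto simp: c_def)
  qed
qed

text \<open>For coroots that are not parallel, their product is a nonzero eigenvector for both
  eigenvalues, which therefore agree. For any y the eigenspace now contains all coroots, so it is
  stable and hence everything.\<close>

theorem invariant_tensor_eq_gram:
  assumes irr: "irreducible_action (weyl_group Phi coroot)" and ne: "Phi \<noteq> {}"
  obtains \<kappa> :: complex where "\<And>x y v w. R x y v w = \<kappa> * gram x y v w"
proof -
  obtain \<gamma> where \<gamma>: "\<gamma> \<in> Phi" using ne by blast
  obtain \<kappa> where \<kappa>: "\<And>y. eigen \<kappa> (coroot \<gamma>) y" using coroot_eigen[OF irr \<gamma>] by blast
  have roots: "eigen \<kappa> (coroot \<delta>) y" if \<delta>: "\<delta> \<in> Phi" for \<delta> y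
  proof (cases "gram (coroot \<gamma>) (coroot \<delta>) (coroot \<gamma>) (coroot \<delta>) = 0")
    case True
    then obtain t where "coroot \<delta> = t *\<^sub>R coroot \<gamma>"
      using gram_degenerate coroot_nonzero[OF \<gamma>] by metis
    then show ?thesis using \<kappa> eigen_scale by metis
  next
    case False
    obtain \<mu> where \<mu>: "\<And>y. eigen \<mu> (coroot \<delta>) y" using coroot_eigen[OF irr \<delta>] by blast
    have "eigen \<mu> (coroot \<gamma>) (coroot \<delta>)" using \<mu> eigen_commute by blast
    with \<kappa>[of "coroot \<delta>"] False have "\<mu> = \<kappa>"
      unfolding eigen_def by (metis mult_right_cancel of_real_eq_0_iff)
    with \<mu> show ?thesis by simp
  qed
  have "{x. eigen \<kappa> y x} = UNIV" for y
  proof (rule irreducible_stable_subspace[OF irr subspace_eigen])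
    show "coroot \<gamma> \<in> {x. eigen \<kappa> y x}" using \<kappa> eigen_commute by blast
    show "coroot \<gamma> \<noteq> 0" using \<gamma> by (rule coroot_nonzero)
  qed (use roots eigen_commute reflect_in_eigen in blast)
  then have "eigen \<kappa> y x" for x y by blast
  then show thesis using that unfolding eigen_def by blast
qed

end


section \<open>The tensor of a weighted root system\<close>

locale weighted_roots = root_form Phi coroot B
  for Phi :: "(real^'n) set" and coroot and B +
  fixes k :: "real^'n \<Rightarrow> complex"
  assumes parameter: "invariant_parameter Phi coroot k"
begin

text \<open>The commutator of the two reflections carries the factor 4 B a c / (B a a * B c c); its
  square divided by 16 * B a c leaves this coefficient. It vanishes on orthogonal pairs, in
  agreement with their omission from the sum.\<close>

definition weight :: "real^'n \<Rightarrow> real^'n \<Rightarrow> complex"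
  where "weight \<alpha> \<beta> = k \<alpha> * k \<beta> *
    of_real (B (coroot \<alpha>) (coroot \<beta>) / ((B (coroot \<alpha>) (coroot \<alpha>))\<^sup>2 * (B (coroot \<beta>) (coroot \<beta>))\<^sup>2))"

definition pair_tensor ::
    "real^'n \<Rightarrow> real^'n \<Rightarrow> real^'n \<Rightarrow> real^'n \<Rightarrow> real^'n \<Rightarrow> real^'n \<Rightarrow> complex"
  where "pair_tensor \<alpha> \<beta> x y v w = weight \<alpha> \<beta> *
    of_real (gram (coroot \<alpha>) (coroot \<beta>) x y * gram (coroot \<alpha>) (coroot \<beta>) v w)"

definition root_tensor ::
    "(real^'n) set \<Rightarrow> real^'n \<Rightarrow> real^'n \<Rightarrow> real^'n \<Rightarrow> real^'n \<Rightarrow> complex"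
  where "root_tensor P x y v w = (\<Sum>\<alpha>\<in>P. \<Sum>\<beta>\<in>P. pair_tensor \<alpha> \<beta> x y v w)"

lemma parameter_reflect: "\<gamma> \<in> Phi \<Longrightarrow> \<beta> \<in> Phi \<Longrightarrow> k (sd \<gamma> \<beta>) = k \<beta>"
  using parameter by (simp add: invariant_parameter_def)

lemma gram_reflect: "\<gamma> \<in> Phi \<Longrightarrow> gram (s \<gamma> x) (s \<gamma> y) (s \<gamma> v) (s \<gamma> w) = gram x y v w"
  by (simp add: gram_def form_reflect)

lemma weight_reflect:
  "\<gamma> \<in> Phi \<Longrightarrow> \<alpha> \<in> Phi \<Longrightarrow> \<beta> \<in> Phi \<Longrightarrow> weight (sd \<gamma> \<alpha>) (sd \<gamma> \<beta>) = weight \<alpha> \<beta>"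
  by (simp add: weight_def parameter_reflect coroot_dual_reflect form_reflect)

lemma pair_tensor_reflect:
  "\<gamma> \<in> Phi \<Longrightarrow> \<alpha> \<in> Phi \<Longrightarrow> \<beta> \<in> Phi \<Longrightarrow>
    pair_tensor (sd \<gamma> \<alpha>) (sd \<gamma> \<beta>) (s \<gamma> x) (s \<gamma> y) (s \<gamma> v) (s \<gamma> w) = pair_tensor \<alpha> \<beta> x y v w"
  by (simp add: pair_tensor_def weight_reflect coroot_dual_reflect gram_reflect)

lemma pair_tensor_commute: "pair_tensor \<alpha> \<beta> x y v w = pair_tensor \<beta> \<alpha> x y v w"
  by (simp add: pair_tensor_def weight_def gram_sym(2)[of "coroot \<alpha>" "coroot \<beta>"] form_commute mult.commute mult.left_commute)

text \<open>The two \<open>gram\<close> factors together are even in the root, whereas the weight is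
  odd through B.\<close>

lemma pair_tensor_uminus_left:
  assumes "\<alpha> \<in> Phi"
  shows "pair_tensor (- \<alpha>) \<beta> x y v w = - pair_tensor \<alpha> \<beta> x y v w"
  using parameter_reflect[OF assms assms] assms
  by (simp add: pair_tensor_def weight_def uminus_root coroot_uminus form_simps gram_simps)

lemma pair_tensor_uminus_right:
  assumes "\<beta> \<in> Phi"
  shows "pair_tensor \<alpha> (- \<beta>) x y v w = - pair_tensor \<alpha> \<beta> x y v w"
  using pair_tensor_uminus_left[OF assms] pair_tensor_commute by metis

text \<open>
  Reflecting the second root in the first one changes neither the product of the coroots in the
  exterior square nor the weight, except for the sign of \<open>B \<alpha>\<^sup>\<or> \<beta>\<^sup>\<or>\<close>.
\<close>

lemma pair_tensor_reflect_right:
  assumes "\<alpha> \<in> Phi" "\<beta> \<in> Phi"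
  shows "pair_tensor \<alpha> (sd \<alpha> \<beta>) x y v w = - pair_tensor \<alpha> \<beta> x y v w"
proof -
  have "B (coroot \<alpha>) (s \<alpha> (coroot \<beta>)) = - B (coroot \<alpha>) (coroot \<beta>)"
    using form_reflect_left[OF assms(1), of "coroot \<alpha>" "coroot \<beta>"] assms
    by (simp add: reflect_coroot form_simps)
  moreover have "gram (coroot \<alpha>) (s \<alpha> (coroot \<beta>)) v w = gram (coroot \<alpha>) (coroot \<beta>) v w" for v w
    by (simp add: reflect_scaleR gram_simps gram_sym(3))
  ultimately show ?thesis
    using assms
    by (simp add: pair_tensor_def weight_def coroot_dual_reflect parameter_reflect form_reflect)
qed

section \<open>Independence of the choice of positive roots\<close>

definition signed_sum ::
    "real^'n \<Rightarrow> real^'n \<Rightarrow> real^'n \<Rightarrow> real^'n \<Rightarrow> real^'n \<Rightarrow> complex"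
  where "signed_sum z x y v w =
    (\<Sum>\<alpha>\<in>Phi. \<Sum>\<beta>\<in>Phi. of_real (sgn (pairing \<alpha> z) * sgn (pairing \<beta> z)) * pair_tensor \<alpha> \<beta> x y v w)"

lemma sum_odd_roots:
  fixes f :: "real^'n \<Rightarrow> complex"
  assumes reg: "\<And>\<alpha>. \<alpha> \<in> Phi \<Longrightarrow> pairing \<alpha> z \<noteq> 0"
    and odd: "\<And>\<alpha>. \<alpha> \<in> Phi \<Longrightarrow> f (- \<alpha>) = - f \<alpha>"
  shows "(\<Sum>\<alpha>\<in>Phi. of_real (sgn (pairing \<alpha> z)) * f \<alpha>) = 2 * (\<Sum>\<alpha>\<in>{\<alpha>\<in>Phi. pairing \<alpha> z > 0}. f \<alpha>)"
proof -
  let ?P = "{\<alpha>\<in>Phi. pairing \<alpha> z > 0}" and ?N = "{\<alpha>\<in>Phi. pairing \<alpha> z < 0}"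
  have "Phi = ?P \<union> ?N" using reg by force
  then have "(\<Sum>\<alpha>\<in>Phi. of_real (sgn (pairing \<alpha> z)) * f \<alpha>) =
      (\<Sum>\<alpha>\<in>?P \<union> ?N. of_real (sgn (pairing \<alpha> z)) * f \<alpha>)" by simp
  also have "\<dots> = (\<Sum>\<alpha>\<in>?P. of_real (sgn (pairing \<alpha> z)) * f \<alpha>) +
      (\<Sum>\<alpha>\<in>?N. of_real (sgn (pairing \<alpha> z)) * f \<alpha>)"
    by (rule sum.union_disjoint) (auto simp: finite_roots)
  also have "(\<Sum>\<alpha>\<in>?N. of_real (sgn (pairing \<alpha> z)) * f \<alpha>) = (\<Sum>\<alpha>\<in>?P. f \<alpha>)"
    by (rule sum.reindex_bij_witness[where i = uminus and j = uminus])
       (auto simp: uminus_root_in odd pairing_simps)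
  finally show ?thesis by simp
qed

text \<open>Over all roots, reflections act on the index set and the chamber enters only through
  signs. Each of the two odd sums contributes a factor 2.\<close>

lemma signed_sum_eq_root_tensor:
  assumes reg: "\<And>\<alpha>. \<alpha> \<in> Phi \<Longrightarrow> pairing \<alpha> z \<noteq> 0"
  shows "signed_sum z x y v w = 4 * root_tensor {\<alpha>\<in>Phi. pairing \<alpha> z > 0} x y v w"
proof -
  let ?P = "{\<alpha>\<in>Phi. pairing \<alpha> z > 0}"
  have "signed_sum z x y v w = (\<Sum>\<alpha>\<in>Phi. of_real (sgn (pairing \<alpha> z)) *
      (\<Sum>\<beta>\<in>Phi. of_real (sgn (pairing \<beta> z)) * pair_tensor \<alpha> \<beta> x y v w))"
    by (simp add: signed_sum_def sum_distrib_left mult.assoc)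
  also have "\<dots> = (\<Sum>\<alpha>\<in>Phi. of_real (sgn (pairing \<alpha> z)) *
      (2 * (\<Sum>\<beta>\<in>?P. pair_tensor \<alpha> \<beta> x y v w)))"
    by (intro sum.cong refl arg_cong2[where f = "(*)"] sum_odd_roots)
       (auto simp: reg pair_tensor_uminus_right)
  also have "\<dots> = 2 * (\<Sum>\<alpha>\<in>?P. 2 * (\<Sum>\<beta>\<in>?P. pair_tensor \<alpha> \<beta> x y v w))"
    by (rule sum_odd_roots) (auto simp: reg pair_tensor_uminus_left sum_negf)
  finally show ?thesis by (simp add: root_tensor_def sum_distrib_left)
qed

text \<open>If both or neither of p, r change sign on the way to p', r', both sides vanish. If
  exactly one does, p r' and p' r have opposite signs, so their difference has the sign of p r', and
  the product expands to the left side.\<close>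

lemma sgn_crossing:
  fixes p p' r r' :: real
  assumes "p \<noteq> 0" "p' \<noteq> 0" "r \<noteq> 0" "r' \<noteq> 0"
  shows "sgn p * sgn r - sgn p' * sgn r' =
    sgn (p * r' - p' * r) * (sgn r * sgn r' - sgn p * sgn p')"
proof -
  have opposite: "sgn (x - y) = sgn x" if "sgn x = - sgn y" for x y :: real
    using that by (auto simp: sgn_if split: if_splits)
  have one: "sgn x = 1 \<or> sgn x = - 1" if "x \<noteq> 0" for x :: real
    using that by (auto simp: sgn_if)
  note signs = one[OF assms(1)] one[OF assms(2)] one[OF assms(3)] one[OF assms(4)]
  show ?thesis
  proof (cases "sgn r * sgn r' = sgn p * sgn p'")
    case True
    with signs show ?thesis by auto
  next
    case False
    then have "sgn (p * r') = - sgn (p' * r)"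
      unfolding sgn_mult using signs by auto
    then have "sgn (p * r' - p' * r) = sgn p * sgn r'"
      using opposite sgn_mult by metis
    then show ?thesis using signs by auto
  qed
qed

text \<open>
  The sign of \<open>p r' - p' r\<close> records which of the roots \<open>\<alpha>\<close>, \<open>\<beta>\<close> changes sign first along the
  segment from \<open>z\<close> to \<open>z'\<close>. For fixed \<open>\<alpha>\<close> it is invariant under \<open>\<beta> \<mapsto> s\<^sub>\<alpha> \<beta>\<close>, which changes
  the sign of the summand.
\<close>

lemma signed_sum_independent:
  assumes reg: "\<And>\<alpha>. \<alpha> \<in> Phi \<Longrightarrow> pairing \<alpha> z \<noteq> 0" "\<And>\<alpha>. \<alpha> \<in> Phi \<Longrightarrow> pairing \<alpha> z' \<noteq> 0"
  shows "signed_sum z x y v w = signed_sum z' x y v w"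
proof -
  define D where "D \<alpha> \<beta> = pairing \<alpha> z * pairing \<beta> z' - pairing \<alpha> z' * pairing \<beta> z" for \<alpha> \<beta>
  define h where "h \<alpha> = complex_of_real (sgn (pairing \<alpha> z) * sgn (pairing \<alpha> z'))" for \<alpha>
  let ?f = "\<lambda>\<alpha> \<beta>. of_real (sgn (D \<alpha> \<beta>)) * pair_tensor \<alpha> \<beta> x y v w"
  have f0: "(\<Sum>\<beta>\<in>Phi. ?f \<alpha> \<beta>) = 0" if \<alpha>: "\<alpha> \<in> Phi" for \<alpha>
  proof -
    \<comment> \<open>D is alternating in the two roots, and the reflected root differs from \<beta>
      by a multiple of \<alpha>.\<close>
    have D: "D \<alpha> (sd \<alpha> \<beta>) = D \<alpha> \<beta>" for \<beta>
      unfolding D_def by (simp add: reflect_scaleR pairing_simps flip: scalar_mult_eq_scaleR)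
        (simp add: algebra_simps)
    have "(\<Sum>\<beta>\<in>Phi. ?f \<alpha> \<beta>) = (\<Sum>\<beta>\<in>Phi. ?f \<alpha> (sd \<alpha> \<beta>))"
      by (rule sum.reindex_bij_betw[OF dual_reflect_bij[OF \<alpha>], symmetric])
    also have "\<dots> = - (\<Sum>\<beta>\<in>Phi. ?f \<alpha> \<beta>)"
      by (simp add: D pair_tensor_reflect_right[OF \<alpha>] flip: sum_negf)
    finally show ?thesis by simp
  qed
  have f_anti: "?f \<alpha> \<beta> = - ?f \<beta> \<alpha>" for \<alpha> \<beta>
  proof -
    have "D \<alpha> \<beta> = - D \<beta> \<alpha>" by (simp add: D_def)
    then show ?thesis by (simp add: sgn_minus pair_tensor_commute[of \<alpha> \<beta>])
  qed
  have crossing: "complex_of_real (sgn (pairing \<alpha> z) * sgn (pairing \<beta> z)) -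
      complex_of_real (sgn (pairing \<alpha> z') * sgn (pairing \<beta> z')) =
      (h \<beta> - h \<alpha>) * of_real (sgn (D \<alpha> \<beta>))" if "\<alpha> \<in> Phi" "\<beta> \<in> Phi" for \<alpha> \<beta>
    unfolding h_def D_def of_real_diff[symmetric] sgn_crossing[OF reg(1,2)[OF that(1)] reg(1,2)[OF that(2)]]
    by (simp add: mult.commute)
  have "signed_sum z x y v w - signed_sum z' x y v w =
      (\<Sum>\<alpha>\<in>Phi. \<Sum>\<beta>\<in>Phi. (h \<beta> - h \<alpha>) * ?f \<alpha> \<beta>)"
    unfolding signed_sum_def sum_subtractf[symmetric] left_diff_distrib[symmetric]
    by (intro sum.cong refl) (simp only: crossing mult.assoc)
  \<comment> \<open>After splitting h \<beta> - h \<alpha>, each half has an inner sum over a full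
    root system with h outside. In the half with h \<beta> this takes an exchange of sums and the
    antisymmetry \<open>f_anti\<close>.\<close>
  also have "\<dots> = (\<Sum>\<alpha>\<in>Phi. \<Sum>\<beta>\<in>Phi. h \<beta> * ?f \<alpha> \<beta>) - (\<Sum>\<alpha>\<in>Phi. h \<alpha> * (\<Sum>\<beta>\<in>Phi. ?f \<alpha> \<beta>))"
    by (simp only: left_diff_distrib sum_subtractf sum_distrib_left)
  also have "(\<Sum>\<alpha>\<in>Phi. h \<alpha> * (\<Sum>\<beta>\<in>Phi. ?f \<alpha> \<beta>)) = 0"
    by (rule sum.neutral) (simp add: f0)
  also have "(\<Sum>\<alpha>\<in>Phi. \<Sum>\<beta>\<in>Phi. h \<beta> * ?f \<alpha> \<beta>) = (\<Sum>\<beta>\<in>Phi. \<Sum>\<alpha>\<in>Phi. h \<beta> * ?f \<alpha> \<beta>)"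
    by (rule sum.swap)
  also have "\<dots> = (\<Sum>\<beta>\<in>Phi. - (h \<beta> * (\<Sum>\<alpha>\<in>Phi. ?f \<beta> \<alpha>)))"
    unfolding sum_distrib_left sum_negf[symmetric]
  proof (intro sum.cong refl)
    show "h \<beta> * ?f \<alpha> \<beta> = - (h \<beta> * ?f \<beta> \<alpha>)" for \<alpha> \<beta>
      using f_anti[of \<alpha> \<beta>] by simp
  qed
  also have "\<dots> = 0"
    by (rule sum.neutral) (simp add: f0)
  finally show ?thesis by simp
qed

text \<open>Independence allows z to be replaced by its reflection. Then everything is reflected
  simultaneously, and reindexing both roots undoes it.\<close>

lemma root_tensor_invariant:
  assumes P: "positive_roots Phi P" and \<gamma>: "\<gamma> \<in> Phi"
  shows "root_tensor P (s \<gamma> x) (s \<gamma> y) (s \<gamma> v) (s \<gamma> w) = root_tensor P x y v w"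
proof -
  obtain z where reg: "\<And>\<alpha>. \<alpha> \<in> Phi \<Longrightarrow> pairing \<alpha> z \<noteq> 0" and Pz: "P = {\<alpha>\<in>Phi. pairing \<alpha> z > 0}"
    using P by (auto simp: positive_roots_def)
  have reg': "pairing \<alpha> (s \<gamma> z) \<noteq> 0" if "\<alpha> \<in> Phi" for \<alpha>
    using reg[OF dual_reflect_in[OF \<gamma> that]] by (simp add: pairing_dual_reflect)
  have sgn: "sgn (pairing (sd \<gamma> \<alpha>) (s \<gamma> z)) = sgn (pairing \<alpha> z)" for \<alpha>
    by (simp add: pairing_dual_reflect reflect_involution[OF \<gamma>])
  have "4 * root_tensor P (s \<gamma> x) (s \<gamma> y) (s \<gamma> v) (s \<gamma> w) =
      signed_sum z (s \<gamma> x) (s \<gamma> y) (s \<gamma> v) (s \<gamma> w)"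
    unfolding Pz by (rule signed_sum_eq_root_tensor[OF reg, symmetric])
  also have "\<dots> = signed_sum (s \<gamma> z) (s \<gamma> x) (s \<gamma> y) (s \<gamma> v) (s \<gamma> w)"
    by (rule signed_sum_independent[OF reg reg'])
  also have "\<dots> = signed_sum z x y v w"
    unfolding signed_sum_def
    by (subst (1 2) sum.reindex_bij_betw[OF dual_reflect_bij[OF \<gamma>], symmetric])
       (simp add: sgn pair_tensor_reflect[OF \<gamma>])
  also have "\<dots> = 4 * root_tensor P x y v w"
    unfolding Pz by (rule signed_sum_eq_root_tensor[OF reg])
  finally show ?thesis by simp
qed

lemma root_tensor_eq_gram:
  assumes irr: "irreducible_action (weyl_group Phi coroot)" and P: "positive_roots Phi P"
  obtains \<kappa> :: complex where "\<And>x y v w. root_tensor P x y v w = \<kappa> * gram x y v w"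
proof (cases "Phi = {}")
  case True
  then have "P = {}" using P by (auto simp: positive_roots_def)
  then show thesis by (intro that[of 0]) (simp add: root_tensor_def)
next
  case False
  interpret invariant_tensor Phi coroot B "root_tensor P"
  proof (intro invariant_tensor.intro invariant_tensor_axioms.intro root_form_axioms)
    show "linear (\<lambda>x. root_tensor P x y v w)" for y v w
      unfolding root_tensor_def
      by (intro linear_compose_sum ballI linearI)
         (simp_all add: pair_tensor_def gram_def form_simps algebra_simps
           scaleR_conv_of_real[where 'a = complex])
    show "root_tensor P x y v w = - root_tensor P y x v w" for x y v w
      by (simp add: root_tensor_def pair_tensor_def gram_def algebra_simps flip: sum_negf)
    show "root_tensor P x y v w = root_tensor P v w x y" for x y v w
      by (simp add: root_tensor_def pair_tensor_def mult.commute)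
  qed (rule root_tensor_invariant[OF P])
  show thesis using invariant_tensor_eq_gram[OF irr False] that by blast
qed

end

section \<open>The degree 0 functional on the Weyl algebra\<close>

lemma omega_simps:
  "omega (u + v) w = omega u w + omega v w"
  "omega w (u + v) = omega w u + omega w v"
  "omega (dscale c u) w = c * omega u w"
  "omega w (dscale c u) = c * omega w u"
  by (simp_all add: omega_def dscale_def pairing_def algebra_simps sum.distrib sum_distrib_left)

lemma omega_antisym: "omega u v = - omega v u"
  by (simp add: omega_def)

text \<open>
  The Weyl algebra acts on the symmetric algebra by \<open>u \<mapsto> u + \<partial>\<^sub>u / 2\<close>, where \<open>\<partial>\<^sub>u\<close> is the derivation
  with \<open>\<partial>\<^sub>u y = \<omega>(u, y)\<close>, and a symmetrized product acts on \<open>1\<close> as the commutative product. Hence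
  the degree 0 part is the constant term of the action on \<open>1\<close>. The transposed action on
  functionals, given by their values on words, is \<open>wick_act\<close>, and \<open>contract\<close> is the transpose
  of \<open>\<partial>\<^sub>u\<close>.
\<close>

primrec contract ::
    "('n::finite) doubled \<Rightarrow> ('n doubled list \<Rightarrow> complex) \<Rightarrow> 'n doubled list \<Rightarrow> complex" where
  "contract u F [] = 0"
| "contract u F (y # ys) = omega u y * F ys + contract u (\<lambda>zs. F (y # zs)) ys"

definition wick_act ::
    "('n::finite) doubled \<Rightarrow> ('n doubled list \<Rightarrow> complex) \<Rightarrow> 'n doubled list \<Rightarrow> complex"
  where "wick_act u F ys = F (u # ys) + 1 / 2 * contract u F ys"

definition wick :: "('n::finite) doubled list \<Rightarrow> complex"
  where "wick us = fold wick_act us (\<lambda>ys. if ys = [] then 1 else 0) []"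

definition symmetric_functional :: "('u list \<Rightarrow> 'b) \<Rightarrow> bool"
  where "symmetric_functional F \<longleftrightarrow> (\<forall>x u v y. F (x @ u # v # y) = F (x @ v # u # y))"

definition multilinear_functional :: "(('n::finite) doubled list \<Rightarrow> complex) \<Rightarrow> bool"
  where "multilinear_functional F \<longleftrightarrow>
    (\<forall>x u v y. F (x @ (u + v) # y) = F (x @ u # y) + F (x @ v # y)) \<and>
    (\<forall>x c u y. F (x @ dscale c u # y) = c * F (x @ u # y))"

lemma symmetric_functionalD:
  "symmetric_functional F \<Longrightarrow> F (x @ u # v # y) = F (x @ v # u # y)"
  by (simp add: symmetric_functional_def)

lemma symmetric_functionalD0:
  "symmetric_functional F \<Longrightarrow> F (u # v # y) = F (v # u # y)"
  using symmetric_functionalD[of F "[]"] by simp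

lemma multilinear_functionalD:
  assumes "multilinear_functional F"
  shows "F (x @ (u + v) # y) = F (x @ u # y) + F (x @ v # y)"
    and "F (x @ dscale c u # y) = c * F (x @ u # y)"
  using assms unfolding multilinear_functional_def by blast+

lemma multilinear_functionalD0:
  assumes "multilinear_functional F"
  shows "F ((u + v) # y) = F (u # y) + F (v # y)"
    and "F (dscale c u # y) = c * F (u # y)"
  using multilinear_functionalD[OF assms, of "[]"] by simp_all

lemma symmetric_functional_Cons: "symmetric_functional F \<Longrightarrow> symmetric_functional (\<lambda>y. F (u # y))"
  unfolding symmetric_functional_def by (metis append_Cons)

lemma multilinear_functional_Cons:
  "multilinear_functional F \<Longrightarrow> multilinear_functional (\<lambda>y. F (u # y))"
  unfolding multilinear_functional_def by (metis append_Cons)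

lemma contract_linear:
  "contract u (\<lambda>y. F y + c * G y) ys = contract u F ys + c * contract u G ys"
  by (induction ys arbitrary: F G) (simp_all add: algebra_simps)

lemma contract_add: "contract u (\<lambda>y. F y + G y) ys = contract u F ys + contract u G ys"
  using contract_linear[of u F 1 G] by simp

lemma contract_mult: "contract u (\<lambda>y. c * G y) ys = c * contract u G ys"
  by (induction ys arbitrary: G) (simp_all add: algebra_simps)

lemma contract_divide: "contract u (\<lambda>y. G y / c) ys = contract u G ys / c"
  by (induction ys arbitrary: G) (simp_all add: add_divide_distrib)

lemma contract_left:
  "contract (u + v) F ys = contract u F ys + contract v F ys"
  "contract (dscale c u) F ys = c * contract u F ys"
  by (induction ys arbitrary: F) (simp_all add: omega_simps algebra_simps)

lemma contract_commute: "contract u (contract v F) ys = contract v (contract u F) ys"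
  by (induction ys arbitrary: F) (simp_all add: contract_add contract_mult)

lemma contract_swap:
  assumes "symmetric_functional F"
  shows "contract w F (x @ u # v # y) = contract w F (x @ v # u # y)"
  using assms
proof (induction x arbitrary: F)
  case Nil
  then show ?case by (simp add: symmetric_functionalD0)
next
  case (Cons a x)
  then show ?case
    using symmetric_functionalD[OF Cons.prems, of x u v y]
    by (simp add: symmetric_functional_Cons)
qed

lemma contract_multilinear:
  assumes "multilinear_functional F"
  shows "contract w F (x @ (u + v) # y) = contract w F (x @ u # y) + contract w F (x @ v # y)"
    and "contract w F (x @ dscale c u # y) = c * contract w F (x @ u # y)"
  using assms
proof (induction x arbitrary: F)
  case Nil
  {
    case 1
    then show ?case
      by (simp add: multilinear_functionalD0 omega_simps contract_add algebra_simps)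
  next
    case 2
    then show ?case
      by (simp add: multilinear_functionalD0 omega_simps contract_mult algebra_simps)
  }
next
  case (Cons a x)
  {
    case 1
    then show ?case
      by (simp add: multilinear_functionalD[OF 1] Cons.IH(1)[OF multilinear_functional_Cons[OF 1]] algebra_simps)
  next
    case 2
    then show ?case
      by (simp add: multilinear_functionalD[OF 2] Cons.IH(2)[OF multilinear_functional_Cons[OF 2]] algebra_simps)
  }
qed

lemma symmetric_wick_act: "symmetric_functional F \<Longrightarrow> symmetric_functional (wick_act w F)"
  using symmetric_functionalD[of F "w # _"]
  by (auto simp: symmetric_functional_def[of "wick_act w F"] wick_act_def contract_swap)

lemma multilinear_wick_act: "multilinear_functional F \<Longrightarrow> multilinear_functional (wick_act w F)"
  using multilinear_functionalD[of F "w # _"]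
  by (auto simp: multilinear_functional_def[of "wick_act w F"] wick_act_def contract_multilinear
      algebra_simps)

lemma symmetric_fold:
  "symmetric_functional F \<Longrightarrow> symmetric_functional (fold wick_act us F)"
  by (induction us arbitrary: F) (simp_all add: symmetric_wick_act)

lemma multilinear_fold:
  "multilinear_functional F \<Longrightarrow> multilinear_functional (fold wick_act us F)"
  by (induction us arbitrary: F) (simp_all add: multilinear_wick_act)

lemma wick_act_linear:
  "wick_act u (\<lambda>y. F y + c * G y) = (\<lambda>y. wick_act u F y + c * wick_act u G y)"
  by (simp add: wick_act_def contract_linear fun_eq_iff algebra_simps)

lemma fold_wick_act_linear:
  "fold wick_act us (\<lambda>y. F y + c * G y) = (\<lambda>y. fold wick_act us F y + c * fold wick_act us G y)"
  by (induction us arbitrary: F G) (simp_all add: wick_act_linear)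

text \<open>Each mixed term pairs a multiplication with half a derivation; together they give omega
  u v / 2 - omega v u / 2 = omega u v. Multiplications commute by symmetry of F, and derivations
  commute by \<open>contract_commute\<close>. The operators stand in the reversed order of a
  transposed action.\<close>

lemma wick_act_commutator:
  assumes "symmetric_functional F"
  shows "wick_act v (wick_act u F) = (\<lambda>y. wick_act u (wick_act v F) y + omega u v * F y)"
proof
  fix y
  show "wick_act v (wick_act u F) y = wick_act u (wick_act v F) y + omega u v * F y"
    using symmetric_functionalD0[OF assms, of u v y] omega_antisym[of v u]
      contract_commute[of u v F y]
    by (simp add: wick_act_def[abs_def] contract_add contract_divide add_divide_distrib diff_divide_distrib algebra_simps)
qed

lemma contract_wick_act:
  "wick_act v (contract u F) = (\<lambda>y. contract u (wick_act v F) y + omega u v * F y)"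
proof
  fix y
  show "wick_act v (contract u F) y = contract u (wick_act v F) y + omega u v * F y"
    using contract_commute[of u v F y]
    by (simp add: wick_act_def[abs_def] contract_add contract_divide add_divide_distrib diff_divide_distrib algebra_simps)
qed

text \<open>Moving the derivation by u past a product leaves one term for each letter, in which that
  letter is replaced by its contraction with u.\<close>

lemma fold_wick_act_contract:
  "fold wick_act us (contract u F) y =
    contract u (fold wick_act us F) y + contract u (\<lambda>zs. fold wick_act zs F y) us"
  by (induction us arbitrary: F) (simp_all add: contract_wick_act fold_wick_act_linear)

lemma wick_Nil: "wick [] = 1"
  by (simp add: wick_def)

text \<open>Wick's recursion. On the unit functional the first letter acts only by half its
  contraction; moved past the other letters, that contraction reaches the empty word, where it is 0,
  and leaves the terms of the recursion.\<close>

lemma wick_Cons: "wick (u # us) = 1 / 2 * contract u wick us"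
proof -
  let ?\<epsilon> = "\<lambda>ys :: 'a doubled list. if ys = [] then 1 else (0 :: complex)"
  have *: "wick_act u ?\<epsilon> = (\<lambda>y. 0 + 1 / 2 * contract u ?\<epsilon> y)"
    by (simp add: wick_act_def[abs_def])
  have "fold wick_act us (\<lambda>y. 0 :: complex) = (\<lambda>y. 0)"
    using fold_wick_act_linear[of us "\<lambda>y. 0" "- 1" "\<lambda>y. 0"] by (simp add: fun_eq_iff)
  then have "wick (u # us) = 1 / 2 * fold wick_act us (contract u ?\<epsilon>) []"
    unfolding wick_def fold_Cons o_apply * fold_wick_act_linear by simp
  also have "\<dots> = 1 / 2 * contract u wick us"
    unfolding fold_wick_act_contract wick_def[abs_def] by simp
  finally show ?thesis .
qed

lemma wick_add: "wick (x @ (u + v) # y) = wick (x @ u # y) + wick (x @ v # y)"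
  and wick_scale: "wick (x @ dscale c u # y) = c * wick (x @ u # y)"
proof -
  let ?F = "fold wick_act x (\<lambda>ys :: 'a doubled list. if ys = [] then 1 else (0 :: complex))"
  have F: "multilinear_functional ?F"
    by (rule multilinear_fold) (simp add: multilinear_functional_def)
  have add: "wick_act (u + v) ?F = (\<lambda>z. wick_act u ?F z + 1 * wick_act v ?F z)"
    by (simp add: fun_eq_iff wick_act_def multilinear_functionalD0[OF F] contract_left algebra_simps)
  have "wick_act (dscale c u) ?F = (\<lambda>z. c * wick_act u ?F z)"
    by (simp add: fun_eq_iff wick_act_def multilinear_functionalD0[OF F] contract_left algebra_simps)
  \<comment> \<open>The factor c is written as 1 + (c - 1) to fit the shape F + c * G of
    \<open>fold_wick_act_linear\<close>.\<close>
  also have "\<dots> = (\<lambda>z. wick_act u ?F z + (c - 1) * wick_act u ?F z)"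
    by (simp add: algebra_simps)
  finally have scale: "wick_act (dscale c u) ?F = (\<lambda>z. wick_act u ?F z + (c - 1) * wick_act u ?F z)" .
  show "wick (x @ (u + v) # y) = wick (x @ u # y) + wick (x @ v # y)"
    unfolding wick_def fold_append fold_Cons o_apply add fold_wick_act_linear by simp
  show "wick (x @ dscale c u # y) = c * wick (x @ u # y)"
    unfolding wick_def fold_append fold_Cons o_apply scale fold_wick_act_linear
    by (simp add: algebra_simps)
qed

text \<open>The defining relation of the Weyl algebra inside a word; with \<open>wick_add\<close>
  and \<open>wick_scale\<close> it lets \<open>wick\<close> descend through both quotients.\<close>

lemma wick_swap: "wick (x @ u # v # y) = wick (x @ v # u # y) + omega u v * wick (x @ y)"
proof -
  let ?F = "fold wick_act x (\<lambda>ys :: 'a doubled list. if ys = [] then 1 else (0 :: complex))"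
  have F: "symmetric_functional ?F"
    by (rule symmetric_fold) (simp add: symmetric_functional_def)
  show ?thesis
    unfolding wick_def fold_append fold_Cons o_apply wick_act_commutator[OF F, of v u]
      fold_wick_act_linear by simp
qed

lemma contract_eq_sum:
  "contract u F ys = (\<Sum>j<length ys. omega u (ys ! j) * F (take j ys @ drop (Suc j) ys))"
  by (induction ys arbitrary: F) (simp_all add: sum.lessThan_Suc_shift del: sum.lessThan_Suc)

text \<open>Each contraction of the first letter cancels against the permutation exchanging the two letters.\<close>

lemma wick_permutations:
  assumes "us \<noteq> []"
  shows "(\<Sum>\<sigma> | \<sigma> permutes {..<length us}. wick (map (\<lambda>i. us ! \<sigma> i) [0..<length us])) = 0"
proof -
  obtain m where m: "length us = Suc m" using assms by (cases us) auto
  let ?S = "{\<sigma>. \<sigma> permutes {..<Suc m}}"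
  define L where "L \<sigma> = map (\<lambda>i. us ! \<sigma> (Suc i)) [0..<m]" for \<sigma> :: "nat \<Rightarrow> nat"
  define g where "g j \<sigma> = omega (us ! \<sigma> 0) (L \<sigma> ! j) * wick (take j (L \<sigma>) @ drop (Suc j) (L \<sigma>))" for j \<sigma>
  have wick: "wick (map (\<lambda>i. us ! \<sigma> i) [0..<Suc m]) = 1 / 2 * (\<Sum>j<m. g j \<sigma>)" for \<sigma>
  proof -
    have "map (\<lambda>i. us ! \<sigma> i) [0..<Suc m] = us ! \<sigma> 0 # L \<sigma>"
      by (simp add: L_def upt_conv_Cons map_Suc_upt[symmetric] del: upt_Suc)
    then show ?thesis by (simp add: wick_Cons contract_eq_sum g_def L_def)
  qed
  have "(\<Sum>\<sigma>\<in>?S. g j \<sigma>) = 0" if j: "j < m" for j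
  proof -
    \<comment> \<open>Position j of the tail \<open>L \<sigma>\<close> is position Suc j of the
      whole word.\<close>
    let ?t = "Transposition.transpose 0 (Suc j)"
    have t: "?t permutes {..<Suc m}" by (rule permutes_swap_id) (use j in auto)
    have anti: "g j (\<sigma> \<circ> ?t) = - g j \<sigma>" for \<sigma>
    proof -
      have "take j (L (\<sigma> \<circ> ?t)) = take j (L \<sigma>)" "drop (Suc j) (L (\<sigma> \<circ> ?t)) = drop (Suc j) (L \<sigma>)"
        using j by (auto simp: L_def take_map drop_map Transposition.transpose_def)
      moreover have "L (\<sigma> \<circ> ?t) ! j = us ! \<sigma> 0" "L \<sigma> ! j = us ! \<sigma> (Suc j)"
        using j by (simp_all add: L_def)
      ultimately show ?thesis
        using omega_antisym[of "us ! \<sigma> (Suc j)" "us ! \<sigma> 0"] by (simp add: g_def)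
    qed
    have "(\<Sum>\<sigma>\<in>?S. g j \<sigma>) = (\<Sum>\<sigma>\<in>?S. g j (\<sigma> \<circ> ?t))"
      by (rule sum_permutations_compose_right[OF t])
    then show ?thesis by (simp add: anti sum_negf)
  qed
  then have "(\<Sum>\<sigma>\<in>?S. \<Sum>j<m. g j \<sigma>) = 0"
    by (subst sum.swap) simp
  then show ?thesis
    unfolding m wick sum_distrib_left[symmetric] by simp
qed

section \<open>Descent of the Wick functional to the Weyl algebra\<close>

definition free_state :: "(('n::finite) doubled tword \<Rightarrow>\<^sub>0 complex) \<Rightarrow> complex"
  where "free_state p = (\<Sum>w\<in>Poly_Mapping.keys p. Poly_Mapping.lookup p w * wick (letters w))"

lemma free_state_superset:
  assumes "finite A" "Poly_Mapping.keys p \<subseteq> A"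
  shows "free_state p = (\<Sum>w\<in>A. Poly_Mapping.lookup p w * wick (letters w))"
  unfolding free_state_def using assms
  by (intro sum.mono_neutral_left) (auto simp: in_keys_iff)

lemma free_state_0: "free_state 0 = 0"
  by (simp add: free_state_def)

lemma free_state_add: "free_state (p + q) = free_state p + free_state q"
  using Poly_Mapping.keys_add[of p q]
  by (simp add: free_state_superset[of "Poly_Mapping.keys p \<union> Poly_Mapping.keys q"] lookup_add
      distrib_right sum.distrib)

lemma free_state_diff: "free_state (p - q) = free_state p - free_state q"
  using free_state_add[of "p - q" q] by simp

lemma free_state_single: "free_state (Poly_Mapping.single w c) = c * wick (letters w)"
  by (subst free_state_superset[of "{w}"]) auto

lemma free_state_two_sided:
  assumes "\<And>x c y d. free_state
    (Poly_Mapping.single (TWord x) c * r * Poly_Mapping.single (TWord y) d) = 0"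
  shows "free_state (a * r * b) = 0"
proof (induction a rule: free_induct)
  case (add x c a)
  have "free_state (Poly_Mapping.single (TWord x) c * r * b) = 0"
    by (induction b rule: free_induct)
       (simp_all add: free_state_0 free_state_add distrib_left assms)
  with add show ?case by (simp add: distrib_right free_state_add)
qed (simp add: free_state_0)

lemma free_state_linear_relator:
  assumes "r \<in> linear_relators"
  shows "free_state (a * r * b) = 0"
proof (rule free_state_two_sided)
  fix x y :: "'a doubled list" and c d
  show "free_state (Poly_Mapping.single (TWord x) c * r * Poly_Mapping.single (TWord y) d) = 0"
    using assms unfolding linear_relators_def
  proof (elim UnE CollectE exE conjE)
    fix u v :: "'a doubled" assume r: "r = free_gen (u + v) - free_gen u - free_gen v"
    show ?thesis
      unfolding r left_diff_distrib right_diff_distrib free_monomial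
      by (simp add: free_state_diff free_state_single wick_add distrib_left)
  next
    fix u :: "'a doubled" and t assume r: "r = free_gen (dscale t u) - free_const t * free_gen u"
    have "Poly_Mapping.single (TWord x) c * (free_const t * free_gen u) * Poly_Mapping.single (TWord y) d
      = Poly_Mapping.single (TWord (x @ u # y)) (c * d * t)"
      by (simp add: free_const_def free_gen_def mult_single plus_tword_def zero_tword_def ac_simps)
    then show ?thesis
      unfolding r left_diff_distrib right_diff_distrib free_monomial
      by (simp add: free_state_diff free_state_single wick_scale)
  qed
qed

lift_definition tensor_state :: "('n::finite) tensor_alg \<Rightarrow> complex" is free_state
proof -
  fix p q :: "'n doubled tword \<Rightarrow>\<^sub>0 complex"
  have "free_state r = 0" if "r \<in> ideal2 linear_relators" for r :: "'n doubled tword \<Rightarrow>\<^sub>0 complex"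
    using that
    by (induction rule: ideal2.induct) (simp_all add: free_state_0 free_state_add free_state_linear_relator)
  moreover assume "ideal_rel linear_relators p q"
  ultimately have "free_state (p - q) = 0" by (simp only: ideal_rel_def)
  then show "free_state p = free_state q" by (simp add: free_state_diff)
qed

lemma tensor_state_weyl_relator:
  assumes "r \<in> weyl_relators"
  shows "tensor_state (a * r * b) = 0"
proof -
  obtain u v where r: "r = tgen u * tgen v - tgen v * tgen u - tconst (omega u v)"
    using assms unfolding weyl_relators_def by blast
  obtain p q where ab: "a = abs_tensor_alg p" "b = abs_tensor_alg q"
    by (metis Quotient3_abs_rep Quotient3_tensor_alg)
  let ?r = "free_gen u * free_gen v - free_gen v * free_gen u - free_const (omega u v)"
  have "a * r * b = abs_tensor_alg (p * ?r * q)"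
    by (simp add: r ab tgen_def tconst_def times_tensor_alg.abs_eq minus_tensor_alg.abs_eq)
  moreover have "free_state (p * ?r * q) = 0"
  proof (rule free_state_two_sided)
    fix x c y d
    show "free_state (Poly_Mapping.single (TWord x) c * ?r * Poly_Mapping.single (TWord y) d) = 0"
      by (simp add: free_gen_def free_const_def mult_single plus_tword_def zero_tword_def
          left_diff_distrib right_diff_distrib free_state_diff free_state_single wick_swap[of x u v y]
          distrib_left mult.left_commute)
  qed
  ultimately show ?thesis by (simp add: tensor_state.abs_eq)
qed

lift_definition weyl_state :: "('n::finite) weyl_alg \<Rightarrow> complex" is tensor_state
proof -
  fix p q :: "'n tensor_alg"
  have add: "tensor_state (x + y) = tensor_state x + tensor_state y" for x y :: "'n tensor_alg"
    by transfer (rule free_state_add)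
  have diff: "tensor_state (x - y) = tensor_state x - tensor_state y" for x y :: "'n tensor_alg"
    by transfer (rule free_state_diff)
  have zero: "tensor_state (0 :: 'n tensor_alg) = 0" by transfer (rule free_state_0)
  have "tensor_state r = 0" if "r \<in> ideal2 weyl_relators" for r :: "'n tensor_alg"
    using that
    by (induction rule: ideal2.induct) (simp_all add: zero add tensor_state_weyl_relator)
  moreover assume "ideal_rel weyl_relators p q"
  ultimately have "tensor_state (p - q) = 0" by (simp only: ideal_rel_def)
  then show "tensor_state p = tensor_state q" by (simp add: diff)
qed

definition weyl_of_free :: "(('n::finite) doubled tword \<Rightarrow>\<^sub>0 complex) \<Rightarrow> 'n weyl_alg"
  where "weyl_of_free p = abs_weyl_alg (abs_tensor_alg p)"

lemma weyl_of_free_surj: obtains p where "x = weyl_of_free p"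
  unfolding weyl_of_free_def
  by (metis Quotient3_abs_rep Quotient3_tensor_alg Quotient3_weyl_alg)

lemma weyl_state_weyl_of_free: "weyl_state (weyl_of_free p) = free_state p"
  by (simp add: weyl_of_free_def weyl_state.abs_eq tensor_state.abs_eq)

lemma weyl_of_free_simps:
  "weyl_of_free (p + q) = weyl_of_free p + weyl_of_free q"
  "weyl_of_free (p * q) = weyl_of_free p * weyl_of_free q"
  "weyl_of_free 0 = 0"
  "weyl_of_free 1 = 1"
  "weyl_of_free (free_const c) = wconst c"
  "weyl_of_free (free_gen u) = wgen u"
  by (simp_all add: weyl_of_free_def plus_weyl_alg.abs_eq plus_tensor_alg.abs_eq
      times_weyl_alg.abs_eq times_tensor_alg.abs_eq zero_weyl_alg_def zero_tensor_alg_def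
      one_weyl_alg_def one_tensor_alg_def wconst_def tconst_def wgen_def tgen_def)

abbreviation wprod :: "('n::finite) doubled list \<Rightarrow> 'n weyl_alg"
  where "wprod us \<equiv> prod_list (map wgen us)"

lemma weyl_of_free_single: "weyl_of_free (Poly_Mapping.single (TWord us) c) = wconst c * wprod us"
proof -
  have "weyl_of_free (Poly_Mapping.single (TWord us) 1) = wprod us"
  proof (induction us)
    case Nil
    then show ?case
      using weyl_of_free_simps(4) by (metis list.simps(8) prod_list.Nil single_one zero_tword_def)
  next
    case (Cons u us)
    have "Poly_Mapping.single (TWord (u # us)) 1 = free_gen u * Poly_Mapping.single (TWord us) 1"
      by (simp add: free_gen_def mult_single plus_tword_def)
    with Cons show ?case by (simp add: weyl_of_free_simps)
  qed
  moreover have "Poly_Mapping.single (TWord us) c = free_const c * Poly_Mapping.single (TWord us) 1"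
    by (simp add: free_const_def mult_single)
  ultimately show ?thesis by (simp add: weyl_of_free_simps)
qed

lemma weyl_state_add: "weyl_state (x + y) = weyl_state x + weyl_state y"
  by (rule weyl_of_free_surj[of x], rule weyl_of_free_surj[of y])
     (simp add: weyl_state_weyl_of_free free_state_add flip: weyl_of_free_simps)

lemma weyl_state_0: "weyl_state 0 = 0"
  using weyl_state_add[of 0 0] by simp

lemma weyl_state_diff: "weyl_state (x - y) = weyl_state x - weyl_state y"
  using weyl_state_add[of "x - y" y] by simp

lemma weyl_state_sum: "weyl_state (\<Sum>i\<in>A. f i) = (\<Sum>i\<in>A. weyl_state (f i))"
  by (induction A rule: infinite_finite_induct) (simp_all add: weyl_state_0 weyl_state_add)

lemma weyl_state_wprod: "weyl_state (wprod us) = wick us"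
  using weyl_state_weyl_of_free[of "Poly_Mapping.single (TWord us) 1"]
  by (simp add: weyl_of_free_single free_state_single wconst_1)

lemma weyl_state_scale: "weyl_state (wconst c * x) = c * weyl_state x"
proof -
  obtain p where x: "x = weyl_of_free p" by (rule weyl_of_free_surj)
  have "free_state (free_const c * p) = c * free_state p"
    by (induction p rule: free_induct)
       (simp_all add: free_state_0 free_state_add distrib_left free_const_def mult_single
         free_state_single)
  then show ?thesis
    by (simp add: x weyl_state_weyl_of_free flip: weyl_of_free_simps)
qed

lemma symmetrize_word_eq_wprod:
  "symmetrize_word (TWord us) = wconst (1 / fact (length us)) *
    (\<Sum>\<sigma> | \<sigma> permutes {..<length us}. wprod (permute_list \<sigma> us))"
  by (simp add: symmetrize_word_def Let_def permute_list_def o_def)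

text \<open>By \<open>wick_permutations\<close> the average over all orders of a nonempty word is 0,
  so only the coefficient of the empty word is seen.\<close>

lemma weyl_state_symmetrize_free: "weyl_state (symmetrize_free p) = Poly_Mapping.lookup p 0"
proof (induction p rule: free_induct)
  case (add us c p)
  have "weyl_state (symmetrize_word (TWord us)) = 1 / fact (length us) *
      (\<Sum>\<sigma> | \<sigma> permutes {..<length us}. wick (map (\<lambda>i. us ! \<sigma> i) [0..<length us]))"
    by (simp only: symmetrize_word_eq_wprod weyl_state_scale weyl_state_sum weyl_state_wprod
        permute_list_def)
  then have "weyl_state (symmetrize_word (TWord us)) = (if us = [] then 1 else 0)"
    using wick_permutations[of us] by (simp add: wick_Nil)
  with add show ?case
    by (simp add: symmetrize_free_add symmetrize_free_single weyl_state_add weyl_state_scale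
        lookup_add lookup_single when_def zero_tword_def)
qed (simp add: symmetrize_free_0 weyl_state_0)

section \<open>Surjectivity of symmetrization\<close>

lemma symmetrize_free_scale: "symmetrize_free (free_const c * p) = wconst c * symmetrize_free p"
  by (induction p rule: free_induct)
     (simp_all add: symmetrize_free_0 symmetrize_free_add distrib_left free_const_def mult_single
       symmetrize_free_single wconst_mult mult.assoc)

lemma symmetrize_free_range:
  "0 \<in> range symmetrize_free"
  "x \<in> range symmetrize_free \<Longrightarrow> y \<in> range symmetrize_free \<Longrightarrow> x + y \<in> range symmetrize_free"
  "x \<in> range symmetrize_free \<Longrightarrow> wconst c * x \<in> range symmetrize_free"
  by (auto simp flip: symmetrize_free_0 symmetrize_free_add symmetrize_free_scale)

lemma symmetrize_free_range_sum:
  "(\<And>i. i \<in> A \<Longrightarrow> f i \<in> range symmetrize_free) \<Longrightarrow> sum f A \<in> range symmetrize_free"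
  by (induction A rule: infinite_finite_induct) (simp_all add: symmetrize_free_range)

lemma wprod_swap:
  "wprod (x @ u # v # y) - wprod (x @ v # u # y) = wconst (omega u v) * wprod (x @ y)"
proof -
  have "wprod (x @ u # v # y) - wprod (x @ v # u # y) =
      wprod x * (wgen u * wgen v - wgen v * wgen u) * wprod y"
    by (simp add: algebra_simps)
  then show ?thesis
    by (simp add: wgen_commutator mult.assoc flip: wconst_commutes[of _ "wprod x"])
qed

text \<open>Exchanging neighbours costs a multiple of a product two letters shorter, which
  \<open>shorter\<close> covers; it stands for the induction hypothesis of
  \<open>wprod_in_range\<close>. The prefix p collects the letters already matched.\<close>

lemma wprod_mset_range:
  fixes us vs p :: "('n::finite) doubled list"
  assumes shorter: "\<And>zs :: 'n doubled list. length zs < m \<Longrightarrow> wprod zs \<in> range symmetrize_free"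
    and "mset us = mset vs" "length (p @ us) = m"
  shows "wprod (p @ us) - wprod (p @ vs) \<in> range symmetrize_free"
proof -
  have trans: "x - z \<in> range symmetrize_free"
    if "x - y \<in> range symmetrize_free" "y - z \<in> range symmetrize_free" for x y z :: "'n weyl_alg"
    using symmetrize_free_range(2)[OF that] by simp
  have swap: "wprod (x @ u # v # y) - wprod (x @ v # u # y) \<in> range symmetrize_free"
    if "length (x @ u # v # y) = m" for x y and u v :: "'n doubled"
    unfolding wprod_swap using that by (intro symmetrize_free_range shorter) auto
  have front: "wprod (p @ u # x @ y) - wprod (p @ x @ u # y) \<in> range symmetrize_free"
    if "length (p @ x @ u # y) = m" for p x y and u :: "'n doubled"
    using that
  proof (induction x arbitrary: p)
    case Nil
    then show ?case by (simp add: symmetrize_free_range)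
  next
    case (Cons a x)
    have "wprod (p @ u # a # x @ y) - wprod (p @ a # u # x @ y) \<in> range symmetrize_free"
      using Cons.prems by (intro swap) auto
    moreover have "wprod ((p @ [a]) @ u # x @ y) - wprod ((p @ [a]) @ x @ u # y) \<in> range symmetrize_free"
      using Cons.prems by (intro Cons.IH) auto
    ultimately show ?case
      using trans[of "wprod (p @ u # a # x @ y)" "wprod (p @ a # u # x @ y)" "wprod (p @ a # x @ u # y)"]
      by (simp del: map_append prod_list.append)
  qed
  show ?thesis using assms(2,3)
  proof (induction us arbitrary: p vs)
    case Nil
    then show ?case by (simp add: symmetrize_free_range)
  next
    case (Cons u us)
    then have "u \<in> set vs" by (metis list.set_intros(1) set_mset_mset)
    then obtain x y where vs: "vs = x @ u # y" by (meson split_list)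
    with Cons.prems have "mset us = mset (x @ y)" by simp
    with Cons.prems have "wprod ((p @ [u]) @ us) - wprod ((p @ [u]) @ x @ y) \<in> range symmetrize_free"
      by (intro Cons.IH) auto
    moreover have "length vs = length (u # us)" using Cons.prems(1) by (metis size_mset)
    then have "wprod (p @ u # x @ y) - wprod (p @ x @ u # y) \<in> range symmetrize_free"
      using Cons.prems vs by (intro front) auto
    ultimately show ?case unfolding vs by (simp del: map_append) (blast intro: trans)
  qed
qed

text \<open>A product is the average of its rearrangements, which is a symmetrized word, plus the
  average of its differences from them, which lie in the range by induction on length.\<close>

lemma wprod_in_range: "wprod us \<in> range symmetrize_free"
proof (induction "length us" arbitrary: us rule: less_induct)
  case less
  let ?S = "{\<sigma>. \<sigma> permutes {..<length us}}"
  have "wprod us - wprod (permute_list \<sigma> us) \<in> range symmetrize_free" if "\<sigma> \<in> ?S" for \<sigma>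
    using wprod_mset_range[of "length us" us "permute_list \<sigma> us" "[]"] that less
    by simp
  then have sum: "(\<Sum>\<sigma>\<in>?S. wprod us - wprod (permute_list \<sigma> us)) \<in> range symmetrize_free"
    by (rule symmetrize_free_range_sum)
  have const: "(\<Sum>\<sigma>\<in>A. x) = wconst (of_nat (card A)) * x" for A :: "(nat \<Rightarrow> nat) set" and x :: "'a weyl_alg"
    by (induction A rule: infinite_finite_induct)
       (simp_all add: wconst_0 wconst_add wconst_1 distrib_right)
  have "wprod us = wconst (1 / fact (length us)) * (\<Sum>\<sigma>\<in>?S. wprod us)"
    by (simp add: const card_permutations[of _ "length us"] wconst_1 flip: mult.assoc wconst_mult)
  then have "wprod us = wconst (1 / fact (length us)) * (\<Sum>\<sigma>\<in>?S. wprod us - wprod (permute_list \<sigma> us))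
      + symmetrize_word (TWord us)"
    by (simp add: symmetrize_word_eq_wprod sum_subtractf algebra_simps)
  moreover have "symmetrize_word (TWord us) \<in> range symmetrize_free"
    using symmetrize_free_single[of "TWord us" 1] by (metis mult_1 rangeI wconst_1)
  ultimately show ?case using symmetrize_free_range sum by metis
qed

lemma surj_symmetrize_free: "surj symmetrize_free"
proof -
  have "weyl_of_free p \<in> range symmetrize_free" for p :: "'a doubled tword \<Rightarrow>\<^sub>0 complex"
    by (induction p rule: free_induct)
       (auto simp: weyl_of_free_simps weyl_of_free_single intro: symmetrize_free_range wprod_in_range)
  then show ?thesis by (metis weyl_of_free_surj UNIV_eq_I)
qed

text \<open>By surjectivity \<open>eta x\<close> is a preimage of x, and \<open>weyl_state\<close>
  reads the constant term off any preimage, so the value does not depend on the choice made by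
  \<open>inv\<close>.\<close>

theorem degree0_part_eq_weyl_state: "degree0_part x = weyl_state x"
proof -
  obtain p where "x = symmetrize_free p" using surj_symmetrize_free by (metis surjD)
  then have "x = symmetrize (abs_sym_alg (abs_tensor_alg p))"
    by (simp add: symmetrize.abs_eq symmetrize_tensor.abs_eq)
  then have x: "symmetrize (eta x) = x" by (simp add: eta_def f_inv_into_f)
  obtain q where q: "eta x = abs_sym_alg (abs_tensor_alg q)"
    by (metis Quotient3_abs_rep Quotient3_tensor_alg Quotient3_sym_alg)
  have "x = symmetrize_free q"
    using x by (simp add: q symmetrize.abs_eq symmetrize_tensor.abs_eq)
  moreover have "degree0_part x = Poly_Mapping.lookup q 0"
    by (simp add: degree0_part_def q sym_degree0.abs_eq tensor_degree0.abs_eq)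
  ultimately show ?thesis by (simp add: weyl_state_symmetrize_free)
qed


section \<open>The Casimir elements of \<open>so(n)\<close> and \<open>sl(2)\<close>\<close>

lemma wconst_sum: "wconst (\<Sum>i\<in>A. c i) = (\<Sum>i\<in>A. wconst (c i))"
  by (induction A rule: infinite_finite_induct) (simp_all add: wconst_0 wconst_add)

lemma wconst_diff: "wconst (c - d) = wconst c - wconst d"
  using wconst_add[of "c - d" d, where ?'a = 'a] by simp

lemma wconst_minus: "wconst (- c) = - wconst c"
  using wconst_diff[of 0 c, where ?'a = 'a] by (simp add: wconst_0)

lemma wconst_mult_mult: "wconst c * x * (wconst c' * y) = wconst (c * c') * (x * y)"
  by (metis mult.assoc wconst_left_commute wconst_mult)

lemma wvec_commute: "wvec u * wvec v = wvec v * wvec u"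
  using wgen_commutator[of "(u, 0)" "(v, 0)"]
  by (simp add: wvec_def omega_def pairing_def wconst_0)

lemma wcovec_commute: "wcovec l * wcovec m = wcovec m * wcovec l"
  using wgen_commutator[of "(0, l)" "(0, m)"]
  by (simp add: wcovec_def omega_def pairing_def wconst_0)

lemma wcovec_wvec: "wcovec l * wvec v = wvec v * wcovec l + wconst (pairing l v)"
  using wgen_commutator[of "(0, l)" "(v, 0)"]
  by (simp add: wcovec_def wvec_def omega_def pairing_def algebra_simps)

locale weyl_dual_bases =
  fixes b d :: "'n::finite \<Rightarrow> complex^'n"
  assumes dual: "dual_family b d"
begin

abbreviation e where "e i \<equiv> wvec (b i)"
abbreviation f where "f i \<equiv> wcovec (d i)"

text \<open>With E_ij = e_i f_j this is the sum over i < j of (E_ij - E_ji)^2, written over all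
  pairs of indices.\<close>

definition so_casimir :: "'n weyl_alg"
  where "so_casimir =
    (\<Sum>i\<in>UNIV. \<Sum>j\<in>UNIV. e i * f j * (e i * f j) - e i * f j * (e j * f i))"

lemma f_e: "f j * e i = e i * f j + (if i = j then 1 else 0)"
  using dual by (auto simp: wcovec_wvec dual_family_def wconst_0 wconst_1)

lemma f_e_assoc: "f j * (e i * x) = e i * (f j * x) + (if i = j then x else 0)"
  using arg_cong[OF f_e[of j i], of "\<lambda>y. y * x"] by (simp add: algebra_simps split: if_splits)

lemma e_commute_assoc: "e i * (e j * x) = e j * (e i * x)"
  by (metis mult.assoc wvec_commute)

lemma f_commute_assoc: "f i * (f j * x) = f j * (f i * x)"
  by (metis mult.assoc wcovec_commute)

lemmas ef_simps = f_e f_e_assoc wvec_commute wcovec_commute e_commute_assoc f_commute_assoc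

lemma sum_const: "(\<Sum>i\<in>(UNIV :: 'n set). x) = wconst (of_nat CARD('n)) * x" for x :: "'n weyl_alg"
proof -
  have "(\<Sum>i\<in>A. x) = wconst (of_nat (card A)) * x" if "finite A" for A :: "'n set"
    using that by (induction A) (simp_all add: wconst_0 wconst_add wconst_1 distrib_right)
  then show ?thesis by simp
qed

lemma product_sums: "(\<Sum>i\<in>UNIV. g i) * (\<Sum>j\<in>UNIV. h j) = (\<Sum>i\<in>UNIV. \<Sum>j\<in>UNIV. g i * h j)"
  for g h :: "'n \<Rightarrow> 'n weyl_alg"
  by (simp add: sum_distrib_left sum_distrib_right) (rule sum.swap)

abbreviation (input) euler where "euler \<equiv> \<Sum>i\<in>UNIV. e i * f i"
abbreviation (input) E2 where "E2 \<equiv> \<Sum>i\<in>UNIV. (e i)\<^sup>2"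
abbreviation (input) F2 where "F2 \<equiv> \<Sum>i\<in>UNIV. (f i)\<^sup>2"

lemma euler_squared:
  "euler * euler = (\<Sum>i\<in>UNIV. \<Sum>j\<in>UNIV. e i * (e j * (f i * f j))) + euler"
proof -
  have "e i * f i * (e j * f j) = e i * (e j * (f i * f j)) + (if i = j then e i * f i else 0)" for i j
    by (simp add: mult.assoc f_e_assoc distrib_left)
  then show ?thesis by (simp add: product_sums sum.distrib)
qed

lemma F2_E2: "F2 * E2 = E2 * F2 + wconst 4 * euler + wconst (2 * of_nat CARD('n))"
proof -
  have "wconst 4 = (wconst 1 + wconst 1 + wconst 1 + wconst 1 :: 'n weyl_alg)"
    by (simp flip: wconst_add)
  then have four: "wconst 4 * x = x + x + x + x" for x :: "'n weyl_alg"
    by (simp add: wconst_1 distrib_right)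
  have two: "wconst 2 = (1 + 1 :: 'n weyl_alg)"
    using wconst_add[of 1 1, where ?'a = 'n] by (simp add: wconst_1)
  \<comment> \<open>For i = j the four single contractions give 4 e_i f_i and the two double
    contractions give 2.\<close>
  have "(f i)\<^sup>2 * (e j)\<^sup>2 = (e j)\<^sup>2 * (f i)\<^sup>2 + (if i = j then wconst 4 * (e i * f i) + wconst 2 else 0)"
    for i j
    by (simp add: power2_eq_square mult.assoc ef_simps four two algebra_simps)
  then have "F2 * E2 = (\<Sum>i\<in>UNIV. \<Sum>j\<in>UNIV. (e j)\<^sup>2 * (f i)\<^sup>2) + (\<Sum>i\<in>UNIV. wconst 4 * (e i * f i) + wconst 2)"
    by (simp add: product_sums sum.distrib)
  also have "(\<Sum>i\<in>UNIV. \<Sum>j\<in>UNIV. (e j)\<^sup>2 * (f i)\<^sup>2) = E2 * F2"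
    unfolding product_sums by (rule sum.swap)
  finally show ?thesis
    by (simp add: sum.distrib sum_const add.assoc flip: sum_distrib_left wconst_mult)
       (simp add: mult.commute)
qed

text \<open>The contraction of f_j with e_j in the second product gives n copies of
  \<open>euler\<close>. Two are offset: one by the diagonal contractions in the first product, one
  by normal ordering of euler * euler.\<close>

lemma so_casimir_eq:
  "so_casimir = E2 * F2 - euler * euler - wconst (of_nat CARD('n) - 2) * euler"
proof -
  have 1: "e i * f j * (e i * f j) = (e i)\<^sup>2 * (f j)\<^sup>2 + (if i = j then e i * f i else 0)" for i j
    by (simp add: power2_eq_square mult.assoc f_e_assoc distrib_left)
  have 2: "e i * f j * (e j * f i) = e i * (e j * (f i * f j)) + e i * f i" for i j
    by (simp add: mult.assoc f_e_assoc distrib_left wcovec_commute)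
  have so: "so_casimir = E2 * F2 + euler - ((\<Sum>i\<in>UNIV. \<Sum>j\<in>UNIV. e i * (e j * (f i * f j)))
      + wconst (of_nat CARD('n)) * euler)"
    unfolding so_casimir_def 1 2 sum_subtractf sum.distrib product_sums
    by (simp add: sum_const sum_distrib_left)
  have "wconst (of_nat CARD('n) - 2) * euler = wconst (of_nat CARD('n)) * euler - euler - euler"
    using wconst_add[of 1 1, where ?'a = 'n]
    by (simp add: wconst_diff wconst_1 algebra_simps)
  then show ?thesis unfolding euler_squared so by (simp add: algebra_simps)
qed

text \<open>In terms of N = \<open>euler\<close>, H^2 is N^2 + n N + n^2/4, and by
  \<open>F2_E2\<close> the other summand is - E2 F2 - 2 N - n. The operator part is minus
  \<open>so_casimir\<close>, and the constant is n^2/4 - n.\<close>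

lemma Omega_sl2_eq:
  "Omega_sl2 b d = wconst (of_nat CARD('n) * (of_nat CARD('n) - 4) / 4) - so_casimir"
proof -
  let ?n = "of_nat CARD('n) :: complex"
  let ?N = euler
  have H: "(sl2_H b d)\<^sup>2 = ?N * ?N + wconst ?n * ?N + wconst (?n * ?n / 4)"
  proof -
    have "wconst ?n * ?N = (wconst (?n / 2) + wconst (?n / 2)) * ?N"
      by (simp flip: wconst_add)
    then have "wconst ?n * ?N = wconst (?n / 2) * ?N + ?N * wconst (?n / 2)"
      by (simp only: distrib_right wconst_commutes[of _ ?N])
    moreover have "wconst (?n * ?n / 4) = (wconst (?n / 2) * wconst (?n / 2) :: 'n weyl_alg)"
      by (simp flip: wconst_mult)
    ultimately show ?thesis
      by (simp add: sl2_H_def power2_eq_square algebra_simps)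
  qed
  have "sl2_X d * sl2_Y b + sl2_Y b * sl2_X d = wconst (- 1 / 4) * (F2 * E2 + E2 * F2)"
    by (simp add: sl2_X_def sl2_Y_def wconst_mult_mult distrib_left)
  then have "wconst 2 * (sl2_X d * sl2_Y b + sl2_Y b * sl2_X d) =
      wconst (- 1 / 2) * (F2 * E2 + E2 * F2)"
    by (simp flip: mult.assoc wconst_mult)
  also have "\<dots> = - (E2 * F2) - wconst 2 * ?N - wconst ?n"
  proof -
    have 1: "wconst (- 1 / 2) * x + wconst (- 1 / 2) * x = - x" for x :: "'n weyl_alg"
      unfolding distrib_right[symmetric] wconst_add[symmetric] by (simp add: wconst_minus wconst_1)
    have 2: "wconst (- 1 / 2) * (wconst 4 * x) = - (wconst 2 * x)" for x :: "'n weyl_alg"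
      unfolding mult.assoc[symmetric] wconst_mult[symmetric] by (simp add: wconst_minus)
    have 3: "wconst (- 1 / 2) * wconst (2 * ?n) = (- wconst ?n :: 'n weyl_alg)"
      unfolding wconst_mult[symmetric] by (simp add: wconst_minus)
    show ?thesis
      unfolding F2_E2 distrib_left 2 3 1[of "E2 * F2", symmetric] by (simp only: add_ac diff_conv_add_uminus)
  qed
  finally have XY: "wconst 2 * (sl2_X d * sl2_Y b + sl2_Y b * sl2_X d) =
      - (E2 * F2) - wconst 2 * ?N - wconst ?n" .
  have "wconst (?n * (?n - 4) / 4) = (wconst (?n * ?n / 4) - wconst ?n :: 'n weyl_alg)"
    by (simp add: algebra_simps diff_divide_distrib flip: wconst_diff)
  then show ?thesis
    unfolding Omega_sl2_def H XY so_casimir_eq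
    by (simp add: wconst_diff algebra_simps)
qed

text \<open>For i = j the two words coincide. Otherwise e_i f_j e_i f_j has no complete contraction,
  and e_i f_j e_j f_i has one, worth (-1/2)(1/2); each of the n(n-1) ordered pairs thus contributes
  1/4.\<close>

lemma weyl_state_so_casimir:
  "weyl_state so_casimir = of_nat CARD('n) * (of_nat CARD('n) - 1) / 4"
proof -
  let ?n = "of_nat CARD('n) :: complex"
  have pairing: "pairing (d j) (b i) = (if i = j then 1 else 0)" for i j
    using dual by (simp add: dual_family_def)
  have state: "weyl_state (e i * f j * (e k * f l)) =
      wick [(b i, 0), (0, d j), (b k, 0), (0, d l)]" for i j k l
    unfolding weyl_state_wprod[symmetric] by (simp add: wvec_def wcovec_def mult.assoc)
  have zero: "pairing 0 v = 0" "pairing l 0 = 0" for l v :: "complex^'n"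
    by (simp_all add: pairing_def)
  have "weyl_state (e i * f j * (e i * f j) - e i * f j * (e j * f i)) =
      (if i = j then 0 else 1 / 4)" for i j
    unfolding weyl_state_diff state by (simp add: wick_Cons wick_Nil omega_def zero pairing)
  then have "weyl_state so_casimir =
      (\<Sum>i\<in>(UNIV :: 'n set). \<Sum>j\<in>UNIV. if i = j then 0 else 1 / 4)"
    by (simp add: so_casimir_def weyl_state_sum)
  also have "\<dots> = (\<Sum>i\<in>(UNIV :: 'n set). (\<Sum>j\<in>(UNIV :: 'n set). 1 / 4) - (\<Sum>j\<in>UNIV. if i = j then 1 / 4 else 0))"
    unfolding sum_subtractf[symmetric] by (intro sum.cong refl) auto
  also have "\<dots> = ?n * (?n - 1) / 4"
    by (simp add: algebra_simps diff_divide_distrib)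
  finally show ?thesis .
qed

end

section \<open>Complexification\<close>

lemma re_im_cvec [simp]: "re_vec (cvec u) = u" "im_vec (cvec u) = 0"
  by (simp_all add: re_vec_def im_vec_def cvec_def vec_eq_iff)

lemma re_im_simps:
  "re_vec (u + v) = re_vec u + re_vec v"
  "im_vec (u + v) = im_vec u + im_vec v"
  "re_vec (c *s u) = Re c *\<^sub>R re_vec u - Im c *\<^sub>R im_vec u"
  "im_vec (c *s u) = Re c *\<^sub>R im_vec u + Im c *\<^sub>R re_vec u"
  "re_vec 0 = 0" "im_vec 0 = 0"
  by (simp_all add: re_vec_def im_vec_def vec_eq_iff)

lemma pairing_cvec:
  "pairing (cvec l) v = of_real (pairing l (re_vec v)) + \<i> * of_real (pairing l (im_vec v))"
  by (simp add: pairing_def cvec_def re_vec_def im_vec_def complex_eq_iff Re_sum Im_sum)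

text \<open>Complex linearity, as far as it is needed to compare multilinear functions on real vectors.\<close>

definition csplit :: "(complex^'n \<Rightarrow> complex) \<Rightarrow> bool"
  where "csplit F \<longleftrightarrow> (\<forall>x. F x = F (cvec (re_vec x)) + \<i> * F (cvec (im_vec x)))"

lemma csplitD: "csplit F \<Longrightarrow> F x = F (cvec (re_vec x)) + \<i> * F (cvec (im_vec x))"
  unfolding csplit_def by blast

lemma csplit_eqI:
  assumes "csplit F" "csplit G" "\<And>u. F (cvec u) = G (cvec u)"
  shows "F x = G x"
  using assms unfolding csplit_def by metis

lemma csplit_diff: "csplit F \<Longrightarrow> csplit G \<Longrightarrow> csplit (\<lambda>x. F x - G x)"
  unfolding csplit_def[of "\<lambda>x. F x - G x"]
  using csplitD[of F] csplitD[of G] by (metis (no_types, lifting) add_diff_add right_diff_distrib)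

lemma csplit_mult_left: "csplit F \<Longrightarrow> csplit (\<lambda>x. c * F x)"
  unfolding csplit_def[of "\<lambda>x. c * F x"]
  using csplitD[of F] by (metis (no_types, lifting) distrib_left mult.left_commute)

lemma csplit_mult_right: "csplit F \<Longrightarrow> csplit (\<lambda>x. F x * c)"
  using csplit_mult_left[of F c] by (simp add: mult.commute)

lemma csplit_sum:
  assumes "\<And>i. i \<in> A \<Longrightarrow> csplit (F i)"
  shows "csplit (\<lambda>x. \<Sum>i\<in>A. F i x)"
proof -
  have "(\<Sum>i\<in>A. F i x) = (\<Sum>i\<in>A. F i (cvec (re_vec x)) + \<i> * F i (cvec (im_vec x)))" for x
    by (intro sum.cong refl csplitD assms)
  then show ?thesis unfolding csplit_def sum_distrib_left sum.distrib[symmetric] by blast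
qed

lemma dual_family_expand:
  fixes b d :: "'n::finite \<Rightarrow> complex^'n"
  assumes "dual_family b d"
  shows "v = (\<Sum>i\<in>UNIV. pairing (d i) v *s b i)"
proof -
  define D :: "complex^'n^'n" where "D = (\<chi> i. d i)"
  define M :: "complex^'n^'n" where "M = (\<chi> j i. b i $ j)"
  have "D ** M = mat 1"
    using assms by (simp add: D_def M_def matrix_matrix_mult_def mat_def vec_eq_iff dual_family_def
        pairing_def)
  \<comment> \<open>The rows of D are the covectors, the columns of M the vectors. That a left
    inverse is a right inverse turns duality into spanning.\<close>
  then have "M ** D = mat 1" by (simp add: matrix_left_right_inverse)
  then have "v = M *v (D *v v)"
    by (simp add: matrix_vector_mul_assoc)
  also have "\<dots> = (\<Sum>i\<in>UNIV. pairing (d i) v *s b i)"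
    by (simp add: D_def M_def matrix_vector_mult_def vec_eq_iff pairing_def mult.commute)
  finally show ?thesis .
qed

lemma dual_family_expand_covector:
  fixes b d :: "'n::finite \<Rightarrow> complex^'n"
  assumes "dual_family b d"
  shows "l = (\<Sum>i\<in>UNIV. pairing l (b i) *s d i)"
proof (rule pairing_eqI)
  fix v
  have "pairing l v = pairing l (\<Sum>i\<in>UNIV. pairing (d i) v *s b i)"
    using dual_family_expand[OF assms] by metis
  also have "\<dots> = pairing v (\<Sum>i\<in>UNIV. pairing l (b i) *s d i)"
    unfolding pairing_sum pairing_simps
    by (simp add: pairing_commute[of v] mult.commute)
  finally show "pairing l v = pairing (\<Sum>i\<in>UNIV. pairing l (b i) *s d i) v"
    by (simp add: pairing_commute)
qed

lemma wvec_add: "wvec (u + v) = wvec u + wvec v"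
  by (simp add: wvec_def flip: wgen_add)

lemma wvec_scale: "wvec (c *s v) = wconst c * wvec v"
  by (simp add: wvec_def dscale_def flip: wgen_scale)

lemma wvec_diff: "wvec (u - v) = wvec u - wvec v"
  using wvec_add[of "u - v" v] by simp

lemma wvec_sum:
  fixes v :: "'b \<Rightarrow> complex^'n::finite"
  shows "wvec (\<Sum>i\<in>A. v i) = (\<Sum>i\<in>A. wvec (v i))"
  using wvec_add[of "0 :: complex^'n" 0]
  by (induction A rule: infinite_finite_induct) (simp_all add: wvec_add)

lemma wcovec_add: "wcovec (l + m) = wcovec l + wcovec m"
  by (simp add: wcovec_def flip: wgen_add)

lemma wcovec_scale: "wcovec (c *s l) = wconst c * wcovec l"
  by (simp add: wcovec_def dscale_def flip: wgen_scale)

lemma wcovec_sum: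
  fixes l :: "'b \<Rightarrow> complex^'n::finite"
  shows "wcovec (\<Sum>i\<in>A. l i) = (\<Sum>i\<in>A. wcovec (l i))"
  using wcovec_add[of "0 :: complex^'n" 0]
  by (induction A rule: infinite_finite_induct) (simp_all add: wcovec_add)

lemma nu_rank2:
  "nu (\<lambda>v. (p * pairing l v) *s x - (q * pairing m v) *s y) =
    wconst p * (wvec x * wcovec l) - wconst q * (wvec y * wcovec m)"
proof -
  have axis: "pairing l (axis i 1) = l $ i" for l :: "complex^'n" and i
    by (simp add: pairing_def axis_def if_distrib cong: if_cong)
  have rank1: "(\<Sum>i\<in>UNIV. wconst (c * l $ i) * wvec v * wcovec (axis i 1)) =
      wconst c * (wvec v * wcovec l)" for c l and v :: "complex^'n"
  proof -
    have "wcovec l = wcovec (\<Sum>i\<in>UNIV. l $ i *s axis i 1)"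
      by (simp add: basis_expansion)
    then have "wconst c * (wvec v * wcovec l) =
        (\<Sum>i\<in>UNIV. wconst c * (wvec v * (wconst (l $ i) * wcovec (axis i 1))))"
      by (simp add: wcovec_sum wcovec_scale sum_distrib_left)
    also have "\<dots> = (\<Sum>i\<in>UNIV. wconst (c * l $ i) * wvec v * wcovec (axis i 1))"
      by (intro sum.cong refl) (metis mult.assoc wconst_left_commute wconst_mult)
    finally show ?thesis by simp
  qed
  show ?thesis
    by (simp add: nu_def axis wvec_diff wvec_scale left_diff_distrib sum_subtractf rank1)
qed

section \<open>Commutators of reflections in an orthonormal basis\<close>

context root_form
begin

lemma cform_cvec: "cform B (cvec u) (cvec v) = of_real (B u v)"
  by (simp add: cform_def form_simps complex_eq_iff)

lemma cform_linear:
  "cform B (u + v) w = cform B u w + cform B v w"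
  "cform B (c *s u) w = c * cform B u w"
  "cform B 0 w = 0"
  by (simp_all add: cform_def re_im_simps form_simps complex_eq_iff algebra_simps)

lemma cform_sum: "cform B (\<Sum>i\<in>A. u i) w = (\<Sum>i\<in>A. cform B (u i) w)"
  by (induction A rule: infinite_finite_induct) (simp_all add: cform_linear)

lemma csplit_cform: "csplit (cform B u)" "csplit (\<lambda>u. cform B u v)"
  by (simp_all add: csplit_def cform_def form_simps complex_eq_iff)

lemma pairing_cvec_root:
  assumes "\<alpha> \<in> Phi"
  shows "pairing (cvec \<alpha>) v =
    of_real (2 / B (coroot \<alpha>) (coroot \<alpha>)) * cform B (cvec (coroot \<alpha>)) v"
  by (simp add: pairing_cvec root_eq_form[OF assms] cform_def form_simps complex_eq_iff)

text \<open>The identity and the rank one terms cancel; the two composite terms remain.\<close>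

lemma reflection_commutator_eq:
  assumes "\<alpha> \<in> Phi" "\<beta> \<in> Phi"
  defines "a \<equiv> coroot \<alpha>" and "c \<equiv> coroot \<beta>"
  shows "reflection_commutator coroot \<alpha> \<beta> =
    (\<lambda>v. (of_real (2 * B a c / B a a) * pairing (cvec \<beta>) v) *s cvec a -
      (of_real (2 * B a c / B c c) * pairing (cvec \<alpha>) v) *s cvec c)"
proof -
  have "pairing (cvec \<alpha>) (cvec c) = of_real (2 * B a c / B a a)"
    "pairing (cvec \<beta>) (cvec a) = of_real (2 * B a c / B c c)"
    using assms by (simp_all add: pairing_cvec root_eq_form form_commute pairing_def[of _ 0])
  then show ?thesis
    by (simp add: fun_eq_iff reflection_commutator_def root_reflection_def reflect_def pairing_simps
        a_def c_def vec_eq_iff algebra_simps)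
qed

lemma orthonormal_dual_family:
  assumes "orthonormal_family B b" "dual_family b d"
  shows "pairing (d j) v = cform B v (b j)"
proof -
  have "cform B v (b j) = cform B (\<Sum>i\<in>UNIV. pairing (d i) v *s b i) (b j)"
    using dual_family_expand[OF assms(2)] by metis
  also have "\<dots> = (\<Sum>i\<in>UNIV. if i = j then pairing (d i) v else 0)"
    unfolding cform_sum cform_linear
    using assms(1) by (intro sum.cong) (auto simp: orthonormal_family_def)
  finally show ?thesis by simp
qed

definition cgram :: "real^'n \<Rightarrow> real^'n \<Rightarrow> complex^'n \<Rightarrow> complex^'n \<Rightarrow> complex"
  where "cgram a c x y =
    cform B (cvec a) x * cform B (cvec c) y - cform B (cvec a) y * cform B (cvec c) x"

text \<open>Rewriting the covectors of the roots through the coroots gives both terms the same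
  factor, (2 B a c / B a a) (2 / B c c) and its mirror image, so the result is
  antisymmetric.\<close>

lemma nu_reflection_commutator:
  assumes roots: "\<alpha> \<in> Phi" "\<beta> \<in> Phi"
    and basis: "orthonormal_family B b" "dual_family b d"
  defines "a \<equiv> coroot \<alpha>" and "c \<equiv> coroot \<beta>"
  shows "nu (reflection_commutator coroot \<alpha> \<beta>) = wconst (of_real (4 * B a c / (B a a * B c c))) *
    (\<Sum>i\<in>UNIV. \<Sum>j\<in>UNIV. wconst (cgram a c (b i) (b j)) * (wvec (b i) * wcovec (d j)))"
proof -
  let ?x = "\<lambda>u i. cform B (cvec u) (b i)"
  have vec: "wvec (cvec u) = (\<Sum>i\<in>UNIV. wconst (?x u i) * wvec (b i))" for u
  proof -
    have "wvec (cvec u) = wvec (\<Sum>i\<in>UNIV. pairing (d i) (cvec u) *s b i)"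
      using dual_family_expand[OF basis(2)] by metis
    then show ?thesis by (simp add: wvec_sum wvec_scale orthonormal_dual_family[OF basis])
  qed
  have covec: "wcovec (cvec \<gamma>) = wconst (of_real (2 / B (coroot \<gamma>) (coroot \<gamma>))) *
      (\<Sum>i\<in>UNIV. wconst (?x (coroot \<gamma>) i) * wcovec (d i))" if "\<gamma> \<in> Phi" for \<gamma>
  proof -
    have "wcovec (cvec \<gamma>) = wcovec (\<Sum>i\<in>UNIV. pairing (cvec \<gamma>) (b i) *s d i)"
      using dual_family_expand_covector[OF basis(2)] by metis
    then show ?thesis
      by (simp only: wcovec_sum wcovec_scale pairing_cvec_root[OF that] wconst_mult sum_distrib_left
          mult.assoc)
  qed
  have product: "(\<Sum>i\<in>UNIV. wconst (?x u i) * wvec (b i)) * (\<Sum>j\<in>UNIV. wconst (?x v j) * wcovec (d j)) =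
      (\<Sum>i\<in>UNIV. \<Sum>j\<in>UNIV. wconst (?x u i * ?x v j) * (wvec (b i) * wcovec (d j)))" for u v
    by (simp add: sum_product wconst_mult_mult)
  have scale: "wconst p * (x * (wconst q * y)) = wconst (p * q) * (x * y)" for p q and x y :: "'n weyl_alg"
    by (metis mult.assoc wconst_left_commute wconst_mult)
  let ?\<kappa> = "of_real (4 * B a c / (B a a * B c c)) :: complex"
  have "nu (reflection_commutator coroot \<alpha> \<beta>) =
      wconst ?\<kappa> * (\<Sum>i\<in>UNIV. \<Sum>j\<in>UNIV. wconst (?x a i * ?x c j) * (wvec (b i) * wcovec (d j))) -
      wconst ?\<kappa> * (\<Sum>i\<in>UNIV. \<Sum>j\<in>UNIV. wconst (?x c i * ?x a j) * (wvec (b i) * wcovec (d j)))"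
    unfolding reflection_commutator_eq[OF roots] nu_rank2 covec[OF roots(1)] covec[OF roots(2)] scale
      vec product
    by (simp add: a_def c_def mult.commute)
  then show ?thesis
    unfolding right_diff_distrib[symmetric] sum_subtractf[symmetric] left_diff_distrib[symmetric]
      wconst_diff[symmetric]
    by (simp add: cgram_def mult.commute)
qed

end

context weighted_roots
begin

text \<open>With the root sums innermost, each coefficient is the complex extension of
  \<open>root_tensor\<close> at four basis vectors.\<close>

lemma nu_Omega_W_eq:
  assumes P: "P \<subseteq> Phi" and basis: "orthonormal_family B b" "dual_family b d"
  shows "nu_Omega_W P coroot B k = (\<Sum>i\<in>UNIV. \<Sum>j\<in>UNIV. \<Sum>l\<in>UNIV. \<Sum>m\<in>UNIV.
    wconst (\<Sum>\<alpha>\<in>P. \<Sum>\<beta>\<in>P. weight \<alpha> \<beta> *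
      (cgram (coroot \<alpha>) (coroot \<beta>) (b i) (b j) * cgram (coroot \<alpha>) (coroot \<beta>) (b l) (b m))) *
    (wvec (b i) * wcovec (d j) * (wvec (b l) * wcovec (d m))))"
proof -
  let ?g = "\<lambda>\<alpha> \<beta> i j. cgram (coroot \<alpha>) (coroot \<beta>) (b i) (b j)"
  let ?w = "\<lambda>i j. wvec (b i) * wcovec (d j)"
  have square: "(\<Sum>i\<in>UNIV. \<Sum>j\<in>UNIV. h i j) * (\<Sum>l\<in>UNIV. \<Sum>m\<in>UNIV. h l m) =
      (\<Sum>i\<in>UNIV. \<Sum>j\<in>UNIV. \<Sum>l\<in>UNIV. \<Sum>m\<in>UNIV. h i j * h l m)" for h :: "'n \<Rightarrow> 'n \<Rightarrow> 'n weyl_alg"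
    by (simp only: sum_distrib_right) (simp only: sum_distrib_left)
  have summand: "wconst (1 / 16) * (wconst (k \<alpha> * k \<beta> * (1 / of_real (B (coroot \<alpha>) (coroot \<beta>)))) *
      (nu (reflection_commutator coroot \<alpha> \<beta>))\<^sup>2) =
      (\<Sum>i\<in>UNIV. \<Sum>j\<in>UNIV. \<Sum>l\<in>UNIV. \<Sum>m\<in>UNIV.
        wconst (weight \<alpha> \<beta> * (?g \<alpha> \<beta> i j * ?g \<alpha> \<beta> l m)) * (?w i j * ?w l m))"
    if "\<alpha> \<in> P" "\<beta> \<in> P" for \<alpha> \<beta>
  proof -
    have roots: "\<alpha> \<in> Phi" "\<beta> \<in> Phi" using that P by auto
    let ?B = "B (coroot \<alpha>) (coroot \<beta>)"
    let ?\<kappa> = "of_real (4 * ?B / (B (coroot \<alpha>) (coroot \<alpha>) * B (coroot \<beta>) (coroot \<beta>))) :: complex"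
    have scale: "wconst p * (wconst q * x) = wconst (p * q) * x" for p q and x :: "'n weyl_alg"
      by (simp only: wconst_mult mult.assoc)
    have "1 / 16 * (k \<alpha> * k \<beta> * (1 / of_real ?B) * (?\<kappa> * ?\<kappa>)) = weight \<alpha> \<beta>"
      by (simp add: weight_def power2_eq_square field_simps)
    then have coeff: "wconst (1 / 16) * (wconst (k \<alpha> * k \<beta> * (1 / of_real ?B)) * (wconst (?\<kappa> * ?\<kappa>) * x)) =
        wconst (weight \<alpha> \<beta>) * x" for x :: "'n weyl_alg"
      by (simp only: scale)
    show ?thesis
      unfolding nu_reflection_commutator[OF roots basis] power2_eq_square wconst_mult_mult
      unfolding coeff square wconst_mult_mult
      unfolding sum_distrib_left scale ..
  qed
  have "nu_Omega_W P coroot B k = (\<Sum>\<alpha>\<in>P. \<Sum>\<beta>\<in>P. \<Sum>i\<in>UNIV. \<Sum>j\<in>UNIV. \<Sum>l\<in>UNIV. \<Sum>m\<in>UNIV.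
        wconst (weight \<alpha> \<beta> * (?g \<alpha> \<beta> i j * ?g \<alpha> \<beta> l m)) * (?w i j * ?w l m))"
    unfolding nu_Omega_W_def sum_distrib_left by (intro sum.cong refl summand)
  also have "\<dots> = (\<Sum>i\<in>UNIV. \<Sum>j\<in>UNIV. \<Sum>l\<in>UNIV. \<Sum>m\<in>UNIV. \<Sum>\<alpha>\<in>P. \<Sum>\<beta>\<in>P.
        wconst (weight \<alpha> \<beta> * (?g \<alpha> \<beta> i j * ?g \<alpha> \<beta> l m)) * (?w i j * ?w l m))"
    unfolding sum.swap[of _ UNIV P] ..
  finally show ?thesis by (simp add: wconst_sum sum_distrib_right)
qed

text \<open>Both sides are complex linear in each argument, so the identity passes from real to
  complex vectors one argument at a time, the last first.\<close>

lemma complex_root_tensor: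
  fixes \<kappa> :: complex
  assumes "\<And>x y v w. root_tensor P x y v w = \<kappa> * gram x y v w"
  shows "(\<Sum>\<alpha>\<in>P. \<Sum>\<beta>\<in>P. weight \<alpha> \<beta> *
      (cgram (coroot \<alpha>) (coroot \<beta>) x y * cgram (coroot \<alpha>) (coroot \<beta>) v w)) =
    \<kappa> * (cform B x v * cform B y w - cform B x w * cform B y v)" (is "?R x y v w = ?G x y v w")
proof -
  note intros = csplit_sum csplit_diff csplit_mult_left csplit_mult_right csplit_cform
  have 0: "?R (cvec x) (cvec y) (cvec v) (cvec w) = ?G (cvec x) (cvec y) (cvec v) (cvec w)" for x y v w
    using assms[of x y v w]
    by (simp add: root_tensor_def pair_tensor_def gram_def cgram_def cform_cvec)
  have 1: "?R (cvec x) (cvec y) (cvec v) w = ?G (cvec x) (cvec y) (cvec v) w" for x y v w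
    by (rule csplit_eqI[where F = "?R (cvec x) (cvec y) (cvec v)" and G = "?G (cvec x) (cvec y) (cvec v)", OF _ _ 0]) (unfold cgram_def, (intro intros)+)
  have 2: "?R (cvec x) (cvec y) v w = ?G (cvec x) (cvec y) v w" for x y v w
    by (rule csplit_eqI[where F = "\<lambda>v. ?R (cvec x) (cvec y) v w" and G = "\<lambda>v. ?G (cvec x) (cvec y) v w", OF _ _ 1]) (unfold cgram_def, (intro intros)+)
  have 3: "?R (cvec x) y v w = ?G (cvec x) y v w" for x y v w
    by (rule csplit_eqI[where F = "\<lambda>y. ?R (cvec x) y v w" and G = "\<lambda>y. ?G (cvec x) y v w", OF _ _ 2]) (unfold cgram_def, (intro intros)+)
  show ?thesis
    by (rule csplit_eqI[where F = "\<lambda>x. ?R x y v w" and G = "\<lambda>x. ?G x y v w", OF _ _ 3]) (unfold cgram_def, (intro intros)+)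
qed

text \<open>In an orthonormal basis the Gram determinant is a difference of products of Kronecker
  deltas, which picks out exactly the two products in \<open>so_casimir\<close>.\<close>

lemma nu_Omega_W_eq_so_casimir:
  assumes irr: "irreducible_action (weyl_group Phi coroot)" and P: "positive_roots Phi P"
    and basis: "orthonormal_family B b" "dual_family b d"
  obtains \<kappa> where "nu_Omega_W P coroot B k = wconst \<kappa> * weyl_dual_bases.so_casimir b d"
proof -
  obtain \<kappa> :: complex where \<kappa>: "\<And>x y v w. root_tensor P x y v w = \<kappa> * gram x y v w"
    using root_tensor_eq_gram[OF irr P] by blast
  have PPhi: "P \<subseteq> Phi" using P by (auto simp: positive_roots_def)
  interpret weyl_dual_bases b d by unfold_locales (rule basis)
  let ?t = "\<lambda>i j l m. e i * f j * (e l * f m)"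
  have form: "cform B (b i) (b j) = (if i = j then 1 else 0)" for i j
    using basis(1) by (simp add: orthonormal_family_def)
  have "nu_Omega_W P coroot B k = (\<Sum>i\<in>UNIV. \<Sum>j\<in>UNIV. \<Sum>l\<in>UNIV. \<Sum>m\<in>UNIV.
      wconst (\<kappa> * ((if i = l then 1 else 0) * (if j = m then 1 else 0) -
        (if i = m then 1 else 0) * (if j = l then 1 else 0))) * ?t i j l m)"
    unfolding nu_Omega_W_eq[OF PPhi basis] complex_root_tensor[OF \<kappa>] form ..
  also have "\<dots> = (\<Sum>i\<in>UNIV. \<Sum>j\<in>UNIV. \<Sum>l\<in>UNIV. \<Sum>m\<in>UNIV.
      wconst \<kappa> * ((if m = j then if l = i then ?t i j l m else 0 else 0) -
        (if m = i then if l = j then ?t i j l m else 0 else 0)))"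
    by (intro sum.cong refl) (auto simp: wconst_0 wconst_minus)
  also have "\<dots> = wconst \<kappa> * (\<Sum>i\<in>UNIV. \<Sum>j\<in>UNIV. ?t i j i j - ?t i j j i)"
    by (simp add: sum_subtractf flip: sum_distrib_left)
  finally show thesis using that by (simp add: so_casimir_def)
qed

end

theorem proposition4p13:
  fixes Phi P :: "(real^'n) set"
    and coroot :: "real^'n \<Rightarrow> real^'n"
    and B :: "real^'n \<Rightarrow> real^'n \<Rightarrow> real"
    and k :: "real^'n \<Rightarrow> complex"
    and b d :: "'n \<Rightarrow> complex^'n"
    and n :: complex
  assumes "root_system Phi coroot"
    and "finite (weyl_group Phi coroot)"
    and "irreducible_action (weyl_group Phi coroot)"
    and "positive_roots Phi P"
    and "invariant_inner_form (weyl_group Phi coroot) B"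
    and "invariant_parameter Phi coroot k"
    and "orthonormal_family B b"
    and "dual_family b d"
    and "n = of_nat CARD('n)"
  shows "nu_Omega_W P coroot B k =
    wconst ((n - 4) * degree0_part (nu_Omega_W P coroot B k) / (n - 1)) +
    wconst (- 4 * degree0_part (nu_Omega_W P coroot B k) / (n * (n - 1))) * Omega_sl2 b d"
proof -
  interpret weighted_roots Phi coroot B k
    using assms by unfold_locales
  interpret weyl_dual_bases b d
    using assms by unfold_locales
  obtain \<kappa> where nu: "nu_Omega_W P coroot B k = wconst \<kappa> * so_casimir"
    using nu_Omega_W_eq_so_casimir assms by blast
  have degree0: "degree0_part (nu_Omega_W P coroot B k) = \<kappa> * (n * (n - 1) / 4)"
    by (simp add: nu degree0_part_eq_weyl_state weyl_state_scale weyl_state_so_casimir assms(9))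
  show ?thesis
  proof (cases "n = 1")
    \<comment> \<open>Both divisions are by 0, so the right side is 0; on the left there is only one
      basis index, and the Casimir element vanishes.\<close>
    case True
    then have "CARD('n) = 1" using assms(9) by (metis of_nat_eq_1_iff)
    then obtain z :: 'n where "UNIV = {z}" by (metis card_1_singletonE)
    then have "i = j" for i j :: 'n by (metis UNIV_I singletonD)
    then have "so_casimir = 0"
      unfolding so_casimir_def by (intro sum.neutral ballI) (metis diff_self)
    then show ?thesis using True by (simp add: nu wconst_0)
  next
    case False
    have "n \<noteq> 0" by (simp add: assms(9))
    \<comment> \<open>Inserting the degree 0 part turns the claim into \<kappa> times
      \<open>Omega_sl2_eq\<close>.\<close>
    with False have coeffs: "(n - 4) * (\<kappa> * (n * (n - 1) / 4)) / (n - 1) = \<kappa> * (n * (n - 4) / 4)"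
      "- 4 * (\<kappa> * (n * (n - 1) / 4)) / (n * (n - 1)) = - \<kappa>"
      by (simp_all add: field_simps)
    show ?thesis
      unfolding degree0 coeffs Omega_sl2_eq assms(9)[symmetric] unfolding nu
      by (simp add: wconst_minus right_diff_distrib flip: wconst_mult)
  qed
qed

end
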